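(* Let $F$ be an asymmetric IPR fullerene on $n$ vertices with asymmetric depth $d(F)\in\{2,3\}$, and let $\varphi$ be a nontrivial partial automorphism of $F$ realising $d(F)$, that is, $\operatorname{rank}(\varphi)=n-d(F)$. Then: (i) $\varphi$ is not the local transposition of any pair of vertices of $F$; (ii) $\varphi$ is not an extension of a nontrivial automorphism of a small induced subgraph fixing the remaining vertices: there is no $D'\subseteq\operatorname{dom}(\varphi)$ with $|D'|\le 3$ such that $\varphi$ restricted to $D'$ is a nontrivial automorphism of $F[D']$ and $\varphi$ fixes every vertex of $\operatorname{dom}(\varphi)\setminus D'$; (iii) $\varphi$ is not face-localised: $\operatorname{supp}(\varphi)\not\subseteq V(F^\circ)$ for any face $F^\circ$ of $F$; (iv) $\varphi$ does not decompose as $\alpha\cup\mathrm{id}_R$, where $\alpha$ is a nontrivial automorphism of an induced subgraph $F[C]$ with $C\subset\operatorname{dom}(\varphi)$, the remainder $R=\operatorname{dom}(\varphi)\setminus C$ is fixed pointwise with $|R|\ge 6$, and at most $5-d(F)$ edges of $F$ join $C$ to $R$.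
   Context: All graphs are finite, undirected and simple. A fullerene is a cubic, 3-connected, planar graph (with its essentially unique plane embedding) all of whose faces are pentagons or hexagons. It is IPR if no two pentagonal faces share an edge. $V(F^\circ)$ denotes the set of vertices on the boundary of a face $F^\circ$. $F[S]$ is the subgraph induced by $S$. A graph is asymmetric if its automorphism group is trivial. A partial automorphism $\varphi$ of a graph $F$ is an isomorphism between two induced subgraphs of $F$; $\operatorname{dom}(\varphi)$ and $\operatorname{ran}(\varphi)$ are the vertex sets of these subgraphs and $\operatorname{rank}(\varphi)=|\operatorname{dom}(\varphi)|$. It is nontrivial if $\varphi(x)\ne x$ for some $x\in\operatorname{dom}(\varphi)$. Its support is $\operatorname{supp}(\varphi)=\{v\in\operatorname{dom}(\varphi):\varphi(v)\ne v\}\cup\{v\in\operatorname{ran}(\varphi):\varphi^{-1}(v)\ne v\}$. The asymmetric depth of a graph $F$ of order $n\ge2$ is $d(F)=n-k$, where $k$ is the largest positive integer such that $F$ admits a nontrivial partial automorphism of rank $k$. For distinct vertices $u,v$ let $\Delta_{uv}=(N(u)\setminus\{v\})\,\triangle\,(N(v)\setminus\{u\})$ (symmetric difference of open neighbourhoods with the other vertex excluded). The local transposition of $u,v$ is the partial automorphism that swaps $u$ and $v$ and fixes every vertex of $V(F)\setminus(\Delta_{uv}\cup\{u,v\})$ (its domain is $V(F)\setminus\Delta_{uv}$). *)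

theory Defs
  imports "HOL-Analysis.Analysis"
begin

section \<open>Finite simple graphs\<close>

text \<open>A graph is given by a vertex set \<open>V\<close> and a set \<open>E\<close> of edges, each a two-element subset of \<open>V\<close>.\<close>

definition simple_graph :: "'a set \<Rightarrow> 'a set set \<Rightarrow> bool" where
  "simple_graph V E \<longleftrightarrow> finite V \<and> (\<forall>e\<in>E. e \<subseteq> V \<and> card e = 2)"

definition nbrs :: "'a set set \<Rightarrow> 'a \<Rightarrow> 'a set" where
  "nbrs E v = {w. {v, w} \<in> E}"

definition cubic :: "'a set \<Rightarrow> 'a set set \<Rightarrow> bool" where
  "cubic V E \<longleftrightarrow> (\<forall>v\<in>V. card (nbrs E v) = 3)"

definition induced_edges :: "'a set set \<Rightarrow> 'a set \<Rightarrow> 'a set set" where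
  "induced_edges E S = {e \<in> E. e \<subseteq> S}"

definition connected_graph :: "'a set \<Rightarrow> 'a set set \<Rightarrow> bool" where
  "connected_graph V E \<longleftrightarrow> V \<noteq> {} \<and>
     (\<forall>u\<in>V. \<forall>v\<in>V. (u, v) \<in> {(x, y). x \<in> V \<and> y \<in> V \<and> {x, y} \<in> E}\<^sup>*)"

definition three_connected :: "'a set \<Rightarrow> 'a set set \<Rightarrow> bool" where
  "three_connected V E \<longleftrightarrow> card V > 3 \<and>
     (\<forall>S\<subseteq>V. card S < 3 \<longrightarrow> connected_graph (V - S) (induced_edges E (V - S)))"

definition edges_between :: "'a set set \<Rightarrow> 'a set \<Rightarrow> 'a set \<Rightarrow> 'a set set" where
  "edges_between E A B = {e \<in> E. e \<inter> A \<noteq> {} \<and> e \<inter> B \<noteq> {}}"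

definition cycle_edges :: "'a list \<Rightarrow> 'a set set" where
  "cycle_edges vs = {{vs ! i, vs ! (Suc i mod length vs)} | i. i < length vs}"

definition cycle_in :: "'a set set \<Rightarrow> 'a list \<Rightarrow> bool" where
  "cycle_in E vs \<longleftrightarrow> length vs \<ge> 3 \<and> distinct vs \<and> cycle_edges vs \<subseteq> E"


section \<open>Plane embeddings and fullerenes\<close>

text \<open>
  A plane embedding sends each vertex \<open>v\<close> to a point \<open>pos v\<close> of the plane (here the complex numbers)
  and each edge \<open>e\<close> to an arc \<open>curve e\<close> joining the images of its two ends; arcs meet
  vertices and one another only at common ends.
\<close>

definition plane_embedding ::
  "'a set \<Rightarrow> 'a set set \<Rightarrow> ('a \<Rightarrow> complex) \<Rightarrow> ('a set \<Rightarrow> real \<Rightarrow> complex) \<Rightarrow> bool" where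
  "plane_embedding V E pos curve \<longleftrightarrow>
     inj_on pos V \<and>
     (\<forall>e\<in>E. arc (curve e) \<and> {pathstart (curve e), pathfinish (curve e)} = pos ` e \<and>
            path_image (curve e) \<inter> pos ` V = pos ` e) \<and>
     (\<forall>e\<in>E. \<forall>e'\<in>E. e \<noteq> e' \<longrightarrow>
            path_image (curve e) \<inter> path_image (curve e') = pos ` (e \<inter> e'))"

definition drawing ::
  "'a set \<Rightarrow> 'a set set \<Rightarrow> ('a \<Rightarrow> complex) \<Rightarrow> ('a set \<Rightarrow> real \<Rightarrow> complex) \<Rightarrow> complex set" where
  "drawing V E pos curve = pos ` V \<union> (\<Union>e\<in>E. path_image (curve e))"

text \<open>The faces are the regions of the plane; the unbounded one is included.\<close>

definition faces ::
  "'a set \<Rightarrow> 'a set set \<Rightarrow> ('a \<Rightarrow> complex) \<Rightarrow> ('a set \<Rightarrow> real \<Rightarrow> complex) \<Rightarrow> complex set set" where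
  "faces V E pos curve = components (- drawing V E pos curve)"

definition face_verts :: "'a set \<Rightarrow> ('a \<Rightarrow> complex) \<Rightarrow> complex set \<Rightarrow> 'a set" where
  "face_verts V pos f = {v \<in> V. pos v \<in> frontier f}"

definition face_edges :: "'a set set \<Rightarrow> ('a set \<Rightarrow> real \<Rightarrow> complex) \<Rightarrow> complex set \<Rightarrow> 'a set set" where
  "face_edges E curve f = {e \<in> E. path_image (curve e) \<subseteq> frontier f}"

text \<open>\<open>k_gonal E curve k f\<close>: the region \<open>f\<close> is bounded by (the drawing of) a cycle of length \<open>k\<close>.\<close>

definition k_gonal :: "'a set set \<Rightarrow> ('a set \<Rightarrow> real \<Rightarrow> complex) \<Rightarrow> nat \<Rightarrow> complex set \<Rightarrow> bool" where
  "k_gonal E curve k f \<longleftrightarrow>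
     (\<exists>vs. cycle_in E vs \<and> length vs = k \<and>
           frontier f = (\<Union>e\<in>cycle_edges vs. path_image (curve e)))"

definition fullerene ::
  "'a set \<Rightarrow> 'a set set \<Rightarrow> ('a \<Rightarrow> complex) \<Rightarrow> ('a set \<Rightarrow> real \<Rightarrow> complex) \<Rightarrow> bool" where
  "fullerene V E pos curve \<longleftrightarrow>
     simple_graph V E \<and> cubic V E \<and> three_connected V E \<and> plane_embedding V E pos curve \<and>
     (\<forall>f\<in>faces V E pos curve. k_gonal E curve 5 f \<or> k_gonal E curve 6 f)"

text \<open>IPR: isolated pentagon rule.\<close>

definition IPR ::
  "'a set \<Rightarrow> 'a set set \<Rightarrow> ('a \<Rightarrow> complex) \<Rightarrow> ('a set \<Rightarrow> real \<Rightarrow> complex) \<Rightarrow> bool" where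
  "IPR V E pos curve \<longleftrightarrow>
     (\<forall>f\<in>faces V E pos curve. \<forall>g\<in>faces V E pos curve.
        f \<noteq> g \<and> k_gonal E curve 5 f \<and> k_gonal E curve 5 g \<longrightarrow>
        face_edges E curve f \<inter> face_edges E curve g = {})"


section \<open>Automorphisms and partial automorphisms\<close>

definition graph_iso ::
  "'a set \<Rightarrow> 'a set set \<Rightarrow> 'b set \<Rightarrow> 'b set set \<Rightarrow> ('a \<Rightarrow> 'b) \<Rightarrow> bool" where
  "graph_iso V E V' E' h \<longleftrightarrow>
     bij_betw h V V' \<and> (\<forall>x\<in>V. \<forall>y\<in>V. {x, y} \<in> E \<longleftrightarrow> {h x, h y} \<in> E')"

definition graph_aut :: "'a set \<Rightarrow> 'a set set \<Rightarrow> ('a \<Rightarrow> 'a) \<Rightarrow> bool" where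
  "graph_aut V E h \<longleftrightarrow> graph_iso V E V E h"

text \<open>Automorphisms matter only on the vertex set, so triviality is tested there.\<close>

definition nontrivial_graph_aut :: "'a set \<Rightarrow> 'a set set \<Rightarrow> ('a \<Rightarrow> 'a) \<Rightarrow> bool" where
  "nontrivial_graph_aut V E h \<longleftrightarrow> graph_aut V E h \<and> (\<exists>x\<in>V. h x \<noteq> x)"

definition asymmetric :: "'a set \<Rightarrow> 'a set set \<Rightarrow> bool" where
  "asymmetric V E \<longleftrightarrow> (\<forall>h. graph_aut V E h \<longrightarrow> (\<forall>v\<in>V. h v = v))"

definition partial_aut :: "'a set \<Rightarrow> 'a set set \<Rightarrow> ('a \<rightharpoonup> 'a) \<Rightarrow> bool" where
  "partial_aut V E \<phi> \<longleftrightarrow> dom \<phi> \<subseteq> V \<and> ran \<phi> \<subseteq> V \<and>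
     graph_iso (dom \<phi>) (induced_edges E (dom \<phi>)) (ran \<phi>) (induced_edges E (ran \<phi>)) (the \<circ> \<phi>)"

definition pa_rank :: "('a \<rightharpoonup> 'a) \<Rightarrow> nat" where
  "pa_rank \<phi> = card (dom \<phi>)"

definition nontrivial :: "('a \<rightharpoonup> 'a) \<Rightarrow> bool" where
  "nontrivial \<phi> \<longleftrightarrow> (\<exists>x\<in>dom \<phi>. \<phi> x \<noteq> Some x)"

definition supp :: "('a \<rightharpoonup> 'a) \<Rightarrow> 'a set" where
  "supp \<phi> = {v \<in> dom \<phi>. the (\<phi> v) \<noteq> v} \<union> {v \<in> ran \<phi>. inv_into (dom \<phi>) (the \<circ> \<phi>) v \<noteq> v}"

definition asym_depth :: "'a set \<Rightarrow> 'a set set \<Rightarrow> nat" where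
  "asym_depth V E =
     card V - Max {k. k > 0 \<and> (\<exists>\<phi>. partial_aut V E \<phi> \<and> nontrivial \<phi> \<and> pa_rank \<phi> = k)}"

definition Delta :: "'a set set \<Rightarrow> 'a \<Rightarrow> 'a \<Rightarrow> 'a set" where
  "Delta E u v = sym_diff (nbrs E u - {v}) (nbrs E v - {u})"

definition local_transposition :: "'a set \<Rightarrow> 'a set set \<Rightarrow> 'a \<Rightarrow> 'a \<Rightarrow> ('a \<rightharpoonup> 'a)" where
  "local_transposition V E u v =
     (\<lambda>x. if x \<in> V - Delta E u v
          then Some (if x = u then v else if x = v then u else x) else None)"

end

theory Submission
  imports Defs
begin

text \<open>
  A partial automorphism \<open>\<phi>\<close> whose domain misses at most three vertices cannot move anything
  small. If \<open>\<phi>\<close> moves \<open>x\<close> to \<open>y\<close> and fixes \<open>z\<close>, then \<open>z\<close> is adjacent to both \<open>x\<close> and \<open>y\<close> or to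
  neither, so every vertex adjacent to exactly one of them is moved or missing. An IPR fullerene has
  girth five, hence two neighbourhoods differ in at least four vertices
  (\<open>neighbourhoods_differ\<close>). This settles local transpositions (i) and automorphisms of at most three
  vertices (ii). If the support lies on a face (iii), the neighbour of each support vertex outside
  that face must be missing, because no outside vertex sees two vertices of the face
  (\<open>no_outer_common_neighbour\<close>, which uses that pentagons are isolated). So the support has at most
  three vertices, and comparing neighbourhoods inside the face excludes sizes two and three.

  For (iv), distribute the at most three missing vertices over the two sides, each to the side where
  it has more neighbours. Every one of them adds at most one edge to the cut, so there is
  a cut of at most five edges with \<open>C\<close> on one side and the at least six vertices of \<open>R\<close> on the other.
  By \<open>small_cut_small_side\<close> such a cut has a side with at most five vertices, and by \<open>small_side\<close>
  that side has at most three vertices or is a pentagonal face; these are cases (ii) and (iii).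

  The theorem on small cuts rests on one counting inequality, \<open>inner_faces_ge\<close>: a side \<open>X\<close> of a cut
  with at most five edges contains at least \<open>|E(X)| - |X| + 1\<close> faces. It replaces Euler's formula and
  follows from the fact that every cycle is the boundary of a set of faces.
  The same inequality yields girth five and shows that every 5-cycle bounds a face. For a cut with
  two large sides, peel off from a side the layer of vertices on faces that meet the cut. The
  inequality bounds the size of that side from below. It follows that one can always choose the
  side so that what is left of it is again a large side of a cut that is not larger, and iterating
  contradicts finiteness. The only tight case is a pentagon surrounded by pentagons.

  Only three facts are needed from topology: there are finitely many faces, each edge lies on exactly
  two of them, and a cycle separates the faces so that an edge lies on the cycle iff its two faces
  lie on different sides. Finiteness holds because a face is the inside or the outside of its
  boundary cycle. That an edge has a face on either side of a cycle through it is the Jordan curve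
  theorem, and that it has only one on each side is Janiszewski's theorem.
\<close>

section \<open>Walks and cycles as vertex lists\<close>

fun walk_edges :: "'a list \<Rightarrow> 'a set set" where
  "walk_edges (x # y # zs) = insert {x, y} (walk_edges (y # zs))"
| "walk_edges _ = {}"

lemma walk_edges_nth: "walk_edges vs = {{vs ! i, vs ! Suc i} | i. Suc i < length vs}"
proof (induction vs rule: walk_edges.induct)
  case (1 x y zs)
  have "{{(x # y # zs) ! i, (x # y # zs) ! Suc i} | i. Suc i < length (x # y # zs)}
      = insert {x, y} {{(y # zs) ! i, (y # zs) ! Suc i} | i. Suc i < length (y # zs)}" (is "?A = ?B")
  proof
    show "?A \<subseteq> ?B"
    proof
      fix e assume "e \<in> ?A"
      then obtain i where i: "Suc i < length (x # y # zs)" "e = {(x # y # zs) ! i, (x # y # zs) ! Suc i}" by blast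
      show "e \<in> ?B" using i by (cases i) auto
    qed
    show "?B \<subseteq> ?A"
    proof
      fix e assume "e \<in> ?B"
      then consider "e = {x, y}" | i where "Suc i < length (y # zs)" "e = {(y # zs) ! i, (y # zs) ! Suc i}" by blast
      then show "e \<in> ?A"
      proof cases
        case 1 then show ?thesis by (auto intro!: exI[of _ 0])
      next
        case (2 i) then show ?thesis by (auto intro!: exI[of _ "Suc i"])
      qed
    qed
  qed
  then show ?case using 1 by simp
qed auto

lemma cycle_edges_walk:
  assumes "vs \<noteq> []"
  shows "cycle_edges vs = insert {last vs, hd vs} (walk_edges vs)"
proof -
  have l: "last vs = vs ! (length vs - 1)" "hd vs = vs ! 0" using assms by (auto simp: last_conv_nth hd_conv_nth)
  show ?thesis (is "?A = ?B")
  proof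
    show "?A \<subseteq> ?B"
    proof
      fix e assume "e \<in> ?A"
      then obtain i where i: "i < length vs" "e = {vs ! i, vs ! (Suc i mod length vs)}"
        unfolding cycle_edges_def by blast
      show "e \<in> ?B"
      proof (cases "Suc i < length vs")
        case True then show ?thesis using i unfolding walk_edges_nth by auto
      next
        case False then have "Suc i = length vs" using i by simp
        then have "i = length vs - 1" "Suc i mod length vs = 0" by auto
        then show ?thesis using i l by auto
      qed
    qed
    show "?B \<subseteq> ?A"
    proof
      fix e assume "e \<in> ?B"
      then consider "e = {last vs, hd vs}" | i where "Suc i < length vs" "e = {vs ! i, vs ! Suc i}"
        unfolding walk_edges_nth by blast
      then show "e \<in> ?A"
      proof cases
        case 1 then show ?thesis unfolding cycle_edges_def using assms l
          by (auto intro!: exI[of _ "length vs - 1"])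
      next
        case (2 i) then show ?thesis unfolding cycle_edges_def by (auto intro!: exI[of _ i])
      qed
    qed
  qed
qed

lemma cycle_edges_rotate: "cycle_edges (rotate k vs) = cycle_edges vs"
proof (cases "vs = []")
  case True then show ?thesis by (simp add: cycle_edges_def)
next
  case False
  let ?n = "length vs"
  have n: "?n > 0" using False by simp
  have *: "{rotate k vs ! i, rotate k vs ! (Suc i mod ?n)} = {vs ! ((k + i) mod ?n), vs ! (Suc ((k + i) mod ?n) mod ?n)}"
    if "i < ?n" for i
    using that n by (simp add: nth_rotate mod_simps)
  show ?thesis
  proof
    show "cycle_edges (rotate k vs) \<subseteq> cycle_edges vs"
      unfolding cycle_edges_def using * n by fastforce
    show "cycle_edges vs \<subseteq> cycle_edges (rotate k vs)"
    proof
      fix e assume "e \<in> cycle_edges vs"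
      then obtain j where j: "j < ?n" "e = {vs ! j, vs ! (Suc j mod ?n)}" unfolding cycle_edges_def by blast
      \<comment> \<open>The multiple of the length keeps the subtraction of \<open>k\<close> from truncating.\<close>
      define i where "i = (j + ?n * k - k) mod ?n"
      have "1 * k \<le> ?n * k" using n by (intro mult_le_mono1) linarith
      then have "k \<le> ?n * k" by simp
      then have "k + (j + ?n * k - k) = j + ?n * k" by (metis le_add2 le_add_diff_inverse le_trans)
      then have "(k + i) mod ?n = j" unfolding i_def using j by (metis mod_add_right_eq mod_less mod_mult_self2)
      moreover have "i < ?n" unfolding i_def using n by simp
      ultimately show "e \<in> cycle_edges (rotate k vs)" using *[of i] j unfolding cycle_edges_def by auto
    qed
  qed
qed

text \<open>
  A cycle is cyclic: any of its edges can play the part of the closing edge of the list.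
\<close>

lemma cycle_in_closing_edge:
  assumes "cycle_in E vs" "e \<in> cycle_edges vs"
  obtains ws where "cycle_in E ws" "cycle_edges ws = cycle_edges vs" "e = {last ws, hd ws}"
proof -
  let ?n = "length vs"
  have n: "?n \<ge> 3" "distinct vs" "cycle_edges vs \<subseteq> E" using assms(1) by (auto simp: cycle_in_def)
  obtain i where i: "i < ?n" "e = {vs ! i, vs ! (Suc i mod ?n)}" using assms(2) unfolding cycle_edges_def by blast
  let ?ws = "rotate (Suc i) vs"
  have ne: "?ws \<noteq> []" using n by auto
  have "hd ?ws = vs ! (Suc i mod ?n)" using n ne by (simp add: hd_conv_nth nth_rotate del: rotate_Suc)
  moreover have "last ?ws = vs ! i"
  proof -
    have "last ?ws = ?ws ! (?n - 1)" using ne by (simp add: last_conv_nth)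
    also have "\<dots> = vs ! ((Suc i + (?n - 1)) mod ?n)" using n by (simp add: nth_rotate del: rotate_Suc)
    also have "Suc i + (?n - 1) = i + ?n" using n by simp
    finally show ?thesis using i by simp
  qed
  ultimately have "e = {last ?ws, hd ?ws}" using i(2) by simp
  moreover have "cycle_in E ?ws" using n cycle_edges_rotate[of "Suc i" vs] unfolding cycle_in_def by (metis distinct_rotate length_rotate)
  ultimately show ?thesis by (intro that[of ?ws] cycle_edges_rotate)
qed

lemma Union_cycle_edges:
  assumes "vs \<noteq> []" shows "\<Union>(cycle_edges vs) = set vs"
proof
  have n: "0 < length vs" using assms by simp
  show "\<Union>(cycle_edges vs) \<subseteq> set vs"
    unfolding cycle_edges_def using n by (auto intro!: nth_mem)
  show "set vs \<subseteq> \<Union>(cycle_edges vs)"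
  proof
    fix v assume "v \<in> set vs"
    then obtain i where "i < length vs" "v = vs ! i" by (auto simp: in_set_conv_nth)
    then have "{vs ! i, vs ! (Suc i mod length vs)} \<in> cycle_edges vs" "v \<in> {vs ! i, vs ! (Suc i mod length vs)}"
      unfolding cycle_edges_def by blast+
    then show "v \<in> \<Union>(cycle_edges vs)" by blast
  qed
qed

lemma walk_edges_subset: "e \<in> walk_edges vs \<Longrightarrow> e \<subseteq> set vs"
  by (induction vs rule: walk_edges.induct) auto

lemma walk_edges_take: "walk_edges (take k vs) \<subseteq> walk_edges vs"
  unfolding walk_edges_nth by auto

text \<open>
  Vertices of degree at most one can be deleted without losing the hypothesis. When none is left,
  the first vertex of a longest path has a second neighbour, which must lie on the path.
\<close>

lemma cycle_in_dense:
  assumes "finite X" "X \<noteq> {}" "\<And>e. e \<in> H \<Longrightarrow> e \<subseteq> X \<and> card e = 2" "card X \<le> card H"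
  shows "\<exists>vs. cycle_in H vs"
  using assms
proof (induction "card X" arbitrary: X H rule: less_induct)
  case less
  have finH: "finite H" by (rule finite_subset[of _ "Pow X"]) (use less.prems in auto)
  show ?case
  proof (cases "\<exists>v\<in>X. card {e \<in> H. v \<in> e} \<le> 1")
    case True
    then obtain v where v: "v \<in> X" "card {e \<in> H. v \<in> e} \<le> 1" by blast
    define H' where "H' = {e \<in> H. v \<notin> e}"
    have "H = H' \<union> {e \<in> H. v \<in> e}" unfolding H'_def by blast
    then have "card H \<le> card H' + card {e \<in> H. v \<in> e}" by (metis card_Un_le)
    then have le: "card (X - {v}) \<le> card H'" using v less.prems by simp
    have sub: "\<And>e. e \<in> H' \<Longrightarrow> e \<subseteq> X - {v} \<and> card e = 2" using less.prems(3) unfolding H'_def by blast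
    have ne: "X - {v} \<noteq> {}"
    proof
      assume "X - {v} = {}"
      then have X: "X = {v}" using v by blast
      have "H = {}"
      proof (rule equals0I)
        fix e assume "e \<in> H"
        then have "e \<subseteq> {v}" "card e = 2" using less.prems(3) X by auto
        then show False using card_mono[of "{v}" e] by simp
      qed
      then show False using less.prems(4) X by simp
    qed
    have "\<exists>vs. cycle_in H' vs"
      by (rule less.hyps[of "X - {v}"]) (use card_Diff1_less[OF less.prems(1) v(1)] less.prems(1) ne sub le in auto)
    moreover have "H' \<subseteq> H" unfolding H'_def by blast
    ultimately show ?thesis unfolding cycle_in_def by blast
  next
    case False
    then have deg: "\<And>v. v \<in> X \<Longrightarrow> 2 \<le> card {e \<in> H. v \<in> e}" by force
    define P where "P vs \<longleftrightarrow> vs \<noteq> [] \<and> distinct vs \<and> set vs \<subseteq> X \<and> walk_edges vs \<subseteq> H" for vs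
    obtain x where x: "x \<in> X" using less.prems by blast
    have Px: "P [x]" using x unfolding P_def by simp
    have bound: "\<And>vs. P vs \<Longrightarrow> length vs \<le> card X"
      unfolding P_def using less.prems(1) by (metis card_mono distinct_card)
    obtain vs where vs: "P vs" and max: "\<And>ws. P ws \<Longrightarrow> length ws \<le> length vs"
      using ex_has_greatest_nat[of P "[x]" length "Suc (card X)"] Px bound by (metis le_imp_less_Suc)
    obtain v zs where vz: "vs = v # zs" using vs unfolding P_def by (cases vs) auto
    have vX: "v \<in> X" using vs vz unfolding P_def by simp
    have "\<exists>e\<in>{e \<in> H. v \<in> e}. zs \<noteq> [] \<longrightarrow> e \<noteq> {v, hd zs}"
    proof (rule ccontr)
      assume "\<not> ?thesis"
      then have "{e \<in> H. v \<in> e} \<subseteq> {{v, hd zs}}" by blast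
      then have "card {e \<in> H. v \<in> e} \<le> 1" using card_mono[of "{{v, hd zs}}"] by simp
      then show False using deg[OF vX] by linarith
    qed
    then obtain e where e: "e \<in> H" "v \<in> e" "zs \<noteq> [] \<longrightarrow> e \<noteq> {v, hd zs}" by blast
    have "card e = 2" "e \<subseteq> X" using less.prems(3) e(1) by auto
    then obtain u where u: "e = {v, u}" "u \<noteq> v" "u \<in> X" using e(2)
      by (smt (verit) card_2_iff doubleton_eq_iff insertE insert_subset singletonD)
    have "u \<in> set vs"
    proof (rule ccontr)
      assume "u \<notin> set vs"
      then have "P (u # vs)" using vs u e(1) unfolding P_def vz by (auto simp: insert_commute)
      then show False using max[of "u # vs"] by simp
    qed
    then obtain j where j: "j < length vs" "vs ! j = u" by (auto simp: in_set_conv_nth)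
    have "j \<noteq> 0" using j(2) u(2) unfolding vz by (metis nth_Cons_0)
    moreover have "j \<noteq> 1" using j u e(3) unfolding vz by (cases zs) auto
    ultimately have j2: "j \<ge> 2" by simp
    let ?c = "take (Suc j) vs"
    have "distinct ?c" "length ?c = Suc j" using vs j unfolding P_def by auto
    moreover have "last ?c = u" using j by (simp add: take_Suc_conv_app_nth)
    moreover have "hd ?c = v" using vz by simp
    moreover have "?c \<noteq> []" using vz by simp
    moreover have "walk_edges ?c \<subseteq> H" using vs walk_edges_take[of "Suc j" vs] unfolding P_def by blast
    ultimately have "cycle_in H ?c"
      unfolding cycle_in_def using j2 cycle_edges_walk[of ?c] u e(1) by (auto simp: insert_commute)
    then show ?thesis by blast
  qed
qed

lemma cycle_edges_at_hd:
  assumes "distinct (v # w # zs)" "zs \<noteq> []"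
  shows "{e \<in> cycle_edges (v # w # zs). v \<in> e} = {{v, w}, {v, last zs}}"
proof -
  have "v \<notin> e" if "e \<in> walk_edges (w # zs)" for e
    using walk_edges_subset[OF that] assms by auto
  then show ?thesis
    using cycle_edges_walk[of "v # w # zs"] assms by (auto simp: insert_commute)
qed

lemma cycle_in_from:
  assumes "cycle_in E vs" "v \<in> set vs"
  obtains w zs where "cycle_in E (v # w # zs)" "zs \<noteq> []" "length (v # w # zs) = length vs"
    "cycle_edges (v # w # zs) = cycle_edges vs" "set (v # w # zs) = set vs"
proof -
  obtain i where i: "i < length vs" "v = vs ! i" using assms(2) by (auto simp: in_set_conv_nth)
  define ws where "ws = rotate i vs"
  have ws: "length ws = length vs" "distinct ws" "cycle_edges ws = cycle_edges vs" "set ws = set vs"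
    using assms(1) by (auto simp: ws_def cycle_edges_rotate cycle_in_def)
  have l: "length ws \<ge> 3" using assms(1) ws by (simp add: cycle_in_def)
  have "rotate i vs ! 0 = vs ! ((i + 0) mod length vs)" using i by (intro nth_rotate) linarith
  then have "ws ! 0 = v" using i by (simp add: ws_def)
  then obtain w zs where "ws = v # w # zs" "zs \<noteq> []" using l
    by (cases ws; cases "tl ws"; cases "tl (tl ws)") auto
  then show ?thesis using that[of w zs] ws assms(1) by (simp add: cycle_in_def)
qed

lemma walk_crosses:
  "\<lbrakk>set vs \<inter> X \<noteq> {}; \<not> set vs \<subseteq> X\<rbrakk> \<Longrightarrow> \<exists>e\<in>walk_edges vs. e \<inter> X \<noteq> {} \<and> \<not> e \<subseteq> X"
proof (induction vs rule: walk_edges.induct)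
  case (1 x y zs)
  show ?case
  proof (cases "x \<in> X \<longleftrightarrow> y \<in> X")
    case True
    then have "set (y # zs) \<inter> X \<noteq> {}" "\<not> set (y # zs) \<subseteq> X" using 1(2,3) by auto
    then show ?thesis using 1(1) by auto
  next
    case False then show ?thesis by auto
  qed
qed auto

section \<open>Faces of a plane drawing\<close>

text \<open>
  If the arc contained a disc, its inverse would map the disc injectively onto a parameter interval. A
  disc stays connected without a point, whereas an interval does not survive the loss of an inner
  point.
\<close>

lemma interior_arc_image:
  fixes g :: "real \<Rightarrow> complex"
  assumes "arc g" shows "interior (path_image g) = {}"
proof (rule ccontr)
  assume "interior (path_image g) \<noteq> {}"
  then obtain z r where r: "r > 0" and zr: "ball z r \<subseteq> path_image g"
    by (metis equals0I mem_interior)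
  obtain h where hom: "homeomorphism {0..1} (path_image g) g h"
    using homeomorphism_arc[OF assms] by blast
  then have ch: "continuous_on (path_image g) h" and gh: "\<And>y. y \<in> path_image g \<Longrightarrow> g (h y) = y"
    by (auto simp: homeomorphism_def)
  have injh: "inj_on h (ball z r)" by (metis gh inj_onI subsetD zr)
  have "infinite (ball z r)" using r by (simp add: uncountable_ball uncountable_infinite)
  then have "infinite (h ` ball z r)" using injh by (simp add: finite_image_iff)
  then obtain T where T: "finite T" "card T = 3" "T \<subseteq> h ` ball z r"
    by (metis infinite_arbitrarily_large)
  define a where "a = Min T"
  define c where "c = Max T"
  have "T \<noteq> {}" using T by auto
  have "T - {a, c} \<noteq> {}"
  proof
    assume "T - {a, c} = {}"
    then have "card T \<le> card {a, c}" by (intro card_mono) auto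
    also have "\<dots> \<le> 2" by (simp add: card_insert_if)
    finally show False using T by simp
  qed
  then obtain b where b: "b \<in> T" "b \<noteq> a" "b \<noteq> c" by blast
  have ac: "a \<in> T" "c \<in> T" "a \<le> b" "b \<le> c" unfolding a_def c_def using T \<open>T \<noteq> {}\<close> b by auto
  obtain q where q: "q \<in> ball z r" "b = h q" using b T by blast
  have "connected (ball z r - {q})"
    by (simp add: connected_open_delete)
  then have "connected (h ` (ball z r - {q}))"
    by (rule connected_continuous_image[rotated]) (use ch zr continuous_on_subset in blast)
  moreover have "h ` (ball z r - {q}) = h ` ball z r - {b}"
    using injh q by (auto simp: inj_on_def)
  ultimately have "connected (h ` ball z r - {b})" by simp
  moreover have "a \<in> h ` ball z r - {b}" "c \<in> h ` ball z r - {b}" using ac b T by auto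
  ultimately have "b \<in> h ` ball z r - {b}" using ac by (meson connectedD_interval)
  then show False by blast
qed

lemma interior_finite_Union_empty:
  assumes "finite \<A>" "\<And>A. A \<in> \<A> \<Longrightarrow> closed A \<and> interior A = {}"
  shows "closed (\<Union>\<A>) \<and> interior (\<Union>\<A>) = {}"
  using assms
proof (induction \<A>)
  case (insert A \<A>)
  then have "closed (\<Union>\<A>)" "interior (\<Union>\<A>) = {}" "closed A" "interior A = {}" by auto
  then show ?case using interior_closed_Un_empty_interior[of A "\<Union>\<A>"] by (simp add: closed_Un)
qed simp

locale plane_graph =
  fixes V :: "'a set" and E :: "'a set set" and pos :: "'a \<Rightarrow> complex" and curve :: "'a set \<Rightarrow> real \<Rightarrow> complex"
  assumes graph: "simple_graph V E" and embedding: "plane_embedding V E pos curve"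
begin

abbreviation im :: "'a set \<Rightarrow> complex set" where "im e \<equiv> path_image (curve e)"
abbreviation D :: "complex set" where "D \<equiv> drawing V E pos curve"
abbreviation Fs :: "complex set set" where "Fs \<equiv> faces V E pos curve"

lemma finite_V: "finite V" and edge_V: "e \<in> E \<Longrightarrow> e \<subseteq> V" and edge_card: "e \<in> E \<Longrightarrow> card e = 2"
  using graph by (auto simp: simple_graph_def)

lemma finite_E: "finite E"
  by (meson PowI edge_V finite_Pow_iff finite_V finite_subset subsetI)

lemma inj_pos: "inj_on pos V" using embedding by (simp add: plane_embedding_def)

lemma curve_arc: "e \<in> E \<Longrightarrow> arc (curve e)"
  and curve_ends: "e \<in> E \<Longrightarrow> {pathstart (curve e), pathfinish (curve e)} = pos ` e"
  and curve_vertices: "e \<in> E \<Longrightarrow> im e \<inter> pos ` V = pos ` e"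
  and curve_meet: "\<lbrakk>e \<in> E; e' \<in> E; e \<noteq> e'\<rbrakk> \<Longrightarrow> im e \<inter> im e' = pos ` (e \<inter> e')"
  using embedding by (auto simp: plane_embedding_def)

lemma oriented_arc:
  assumes "{a, b} \<in> E"
  obtains g where "arc g" "pathstart g = pos a" "pathfinish g = pos b" "path_image g = im {a, b}"
proof -
  have "{pathstart (curve {a, b}), pathfinish (curve {a, b})} = {pos a, pos b}"
    using curve_ends[OF assms] by simp
  then consider "pathstart (curve {a, b}) = pos a" "pathfinish (curve {a, b}) = pos b"
    | "pathstart (curve {a, b}) = pos b" "pathfinish (curve {a, b}) = pos a"
    by (auto simp: doubleton_eq_iff)
  then show ?thesis
  proof cases
    case 1 then show ?thesis using that curve_arc[OF assms] by blast
  next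
    case 2
    then show ?thesis using that[of "reversepath (curve {a, b})"] curve_arc[OF assms]
      by (simp add: arc_reversepath)
  qed
qed

lemma im_vertex: "\<lbrakk>e \<in> E; v \<in> V; pos v \<in> im e\<rbrakk> \<Longrightarrow> v \<in> e"
proof -
  assume a: "e \<in> E" "v \<in> V" "pos v \<in> im e"
  then have "pos v \<in> pos ` e" using curve_vertices by blast
  then show "v \<in> e" using inj_pos edge_V a by (metis imageE inj_onD subsetD)
qed

lemma im_Int: "\<lbrakk>e \<in> E; e' \<in> E; e \<noteq> e'; z \<in> im e; z \<in> im e'\<rbrakk> \<Longrightarrow> \<exists>v. v \<in> e \<and> v \<in> e' \<and> z = pos v"
  using curve_meet by blast

lemma walk_arc:
  assumes "distinct vs" "length vs \<ge> 2" "walk_edges vs \<subseteq> E"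
  shows "\<exists>g. arc g \<and> pathstart g = pos (hd vs) \<and> pathfinish g = pos (last vs) \<and>
             path_image g = (\<Union>e\<in>walk_edges vs. im e)"
  using assms
proof (induction vs rule: walk_edges.induct)
  case (1 x y zs)
  have xy: "{x, y} \<in> E" using 1 by simp
  obtain g1 where g1: "arc g1" "pathstart g1 = pos x" "pathfinish g1 = pos y" "path_image g1 = im {x, y}"
    using oriented_arc[OF xy] by blast
  show ?case
  proof (cases zs)
    case Nil then show ?thesis using g1 by (intro exI[of _ g1]) auto
  next
    case (Cons z zs')
    then obtain g2 where g2: "arc g2" "pathstart g2 = pos y" "pathfinish g2 = pos (last (y # zs))"
      "path_image g2 = (\<Union>e\<in>walk_edges (y # zs). im e)"
      using 1 by fastforce
    have "path_image g1 \<inter> path_image g2 \<subseteq> {pathstart g2}"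
    proof
      fix p assume "p \<in> path_image g1 \<inter> path_image g2"
      then obtain e where e: "e \<in> walk_edges (y # zs)" "p \<in> im e" "p \<in> im {x, y}" using g1 g2 by auto
      have xe: "x \<notin> e" using walk_edges_subset[OF e(1)] 1(2) by auto
      then have "e \<noteq> {x, y}" by auto
      moreover have "e \<in> E" using e 1 by auto
      ultimately obtain v where "v \<in> e" "v \<in> {x, y}" "p = pos v" using im_Int[OF _ xy _ e(2,3)] by blast
      then show "p \<in> {pathstart g2}" using xe g2 by auto
    qed
    then have "arc (g1 +++ g2)" using g1 g2 by (intro arc_join) auto
    moreover have "path_image (g1 +++ g2) = (\<Union>e\<in>walk_edges (x # y # zs). im e)"
      using g1 g2 by (simp add: path_image_join)
    ultimately show ?thesis using g1 g2 Cons by (intro exI[of _ "g1 +++ g2"]) auto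
  qed
qed auto

lemma cycle_closing_arc:
  assumes "cycle_in E ws" and e: "e = {last ws, hd ws}"
  obtains g h where "arc g" "pathstart g = pos (hd ws)" "pathfinish g = pos (last ws)"
    "path_image g = (\<Union>e'\<in>cycle_edges ws - {e}. im e')"
    "simple_path h" "pathfinish h = pathstart h" "path_image h = (\<Union>e'\<in>cycle_edges ws. im e')"
proof -
  have c: "length ws \<ge> 3" "distinct ws" "cycle_edges ws \<subseteq> E" using assms by (auto simp: cycle_in_def)
  have ne: "ws \<noteq> []" using c by auto
  have ce: "cycle_edges ws = insert e (walk_edges ws)" using cycle_edges_walk[OF ne] e by simp
  have eE: "{last ws, hd ws} \<in> E" using ce c e by auto
  have enw: "e \<notin> walk_edges ws"
  proof
    assume "e \<in> walk_edges ws"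
    then obtain i where i: "Suc i < length ws" "e = {ws ! i, ws ! Suc i}" unfolding walk_edges_nth by blast
    have l: "last ws = ws ! (length ws - 1)" "hd ws = ws ! 0" using ne by (auto simp: last_conv_nth hd_conv_nth)
    have "{ws ! i, ws ! Suc i} = {ws ! (length ws - 1), ws ! 0}" using i e l by simp
    then have "(ws ! i = ws ! 0 \<and> ws ! Suc i = ws ! (length ws - 1)) \<or> ws ! Suc i = ws ! 0"
      by (auto simp: doubleton_eq_iff)
    moreover have "ws ! Suc i \<noteq> ws ! 0" using nth_eq_iff_index_eq[of ws "Suc i" 0] c i ne by auto
    ultimately have "i = 0" "Suc i = length ws - 1"
      using c i nth_eq_iff_index_eq[of ws i 0] nth_eq_iff_index_eq[of ws "Suc i" "length ws - 1"] ne by auto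
    then show False using c by auto
  qed
  obtain g where g: "arc g" "pathstart g = pos (hd ws)" "pathfinish g = pos (last ws)"
      "path_image g = (\<Union>e'\<in>walk_edges ws. im e')"
    using walk_arc[of ws] c(1,2) order_trans[OF _ c(3), of "walk_edges ws"] unfolding ce by fastforce
  obtain k where k: "arc k" "pathstart k = pos (last ws)" "pathfinish k = pos (hd ws)" "path_image k = im e"
    using oriented_arc[OF eE] e by blast
  have "path_image g \<inter> path_image k \<subseteq> {pathstart g, pathstart k}"
  proof
    fix p assume "p \<in> path_image g \<inter> path_image k"
    then obtain e' where e': "e' \<in> walk_edges ws" "p \<in> im e'" "p \<in> im e" using g k by auto
    then obtain v where "v \<in> e" "p = pos v" using im_Int[of e' e p] enw ce c by auto
    then show "p \<in> {pathstart g, pathstart k}" using e g k by auto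
  qed
  then have "simple_path (g +++ k)"
    using g k by (intro simple_path_join_loop) auto
  moreover have "path_image (g +++ k) = (\<Union>e'\<in>cycle_edges ws. im e')"
    using g k ce by (simp add: path_image_join Un_commute)
  moreover have "cycle_edges ws - {e} = walk_edges ws" using ce enw by auto
  ultimately show ?thesis using that[of g "g +++ k"] g k by simp
qed

abbreviation cyc_im :: "'a list \<Rightarrow> complex set" where "cyc_im vs \<equiv> (\<Union>e\<in>cycle_edges vs. im e)"

lemma cycle_loop:
  assumes "cycle_in E vs"
  obtains h where "simple_path h" "pathfinish h = pathstart h" "path_image h = cyc_im vs"
  by (rule cycle_closing_arc[OF assms refl]) (rule that)

lemma jordan_cycle:
  assumes "cycle_in E vs"
  shows "inside (cyc_im vs) \<noteq> {}" "open (inside (cyc_im vs))" "connected (inside (cyc_im vs))"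
    "outside (cyc_im vs) \<noteq> {}" "open (outside (cyc_im vs))" "connected (outside (cyc_im vs))"
    "inside (cyc_im vs) \<inter> outside (cyc_im vs) = {}"
    "inside (cyc_im vs) \<union> outside (cyc_im vs) = - cyc_im vs"
    "frontier (inside (cyc_im vs)) = cyc_im vs" "frontier (outside (cyc_im vs)) = cyc_im vs"
proof -
  obtain h where h: "simple_path h" "pathfinish h = pathstart h" "path_image h = cyc_im vs"
    by (rule cycle_loop[OF assms]) (rule that)
  from Jordan_inside_outside[OF h(1,2)] show "inside (cyc_im vs) \<noteq> {}" "open (inside (cyc_im vs))" "connected (inside (cyc_im vs))"
    "outside (cyc_im vs) \<noteq> {}" "open (outside (cyc_im vs))" "connected (outside (cyc_im vs))"
    "inside (cyc_im vs) \<inter> outside (cyc_im vs) = {}"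
    "inside (cyc_im vs) \<union> outside (cyc_im vs) = - cyc_im vs"
    "frontier (inside (cyc_im vs)) = cyc_im vs" "frontier (outside (cyc_im vs)) = cyc_im vs"
    unfolding h(3) by auto
qed

lemma closed_im: "e \<in> E \<Longrightarrow> closed (im e)"
  using curve_arc arc_imp_path closed_path_image by blast

lemma drawing_nowhere_dense: "closed D \<and> interior D = {}"
proof -
  have "D = \<Union>((\<lambda>v. {pos v}) ` V \<union> im ` E)" by (auto simp: drawing_def)
  moreover have "closed (\<Union>((\<lambda>v. {pos v}) ` V \<union> im ` E)) \<and> interior (\<Union>((\<lambda>v. {pos v}) ` V \<union> im ` E)) = {}"
    by (rule interior_finite_Union_empty) (use finite_V finite_E closed_im interior_arc_image curve_arc in auto)
  ultimately show ?thesis by simp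
qed

lemma cyc_im_drawing: "cycle_edges vs \<subseteq> E \<Longrightarrow> cyc_im vs \<subseteq> D" by (auto simp: drawing_def)

lemma face_facts:
  assumes "f \<in> Fs"
  shows "open f" "connected f" "f \<noteq> {}" "f \<inter> D = {}"
  using assms drawing_nowhere_dense open_components[of "- D" f] in_components_subset[of f "- D"]
    in_components_connected[of f "- D"] in_components_nonempty[of f "- D"]
  unfolding faces_def by (simp_all add: open_Compl) blast

lemma faces_disjoint: "\<lbrakk>f \<in> Fs; g \<in> Fs; x \<in> f; x \<in> g\<rbrakk> \<Longrightarrow> f = g"
  unfolding faces_def using components_nonoverlap by blast

lemma in_some_face: "x \<notin> D \<Longrightarrow> \<exists>f\<in>Fs. x \<in> f"
  unfolding faces_def using Union_components[of "- D"] by blast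

lemma face_side:
  assumes "f \<in> Fs" "cycle_in E vs"
  shows "f \<subseteq> inside (cyc_im vs) \<or> f \<subseteq> outside (cyc_im vs)"
proof -
  have "f \<inter> cyc_im vs = {}" using face_facts(4)[OF assms(1)] cyc_im_drawing[of vs] assms(2) by (auto simp: cycle_in_def)
  then have "f \<subseteq> inside (cyc_im vs) \<union> outside (cyc_im vs)" using jordan_cycle(8)[OF assms(2)] by blast
  then show ?thesis
    using face_facts(2)[OF assms(1)] jordan_cycle(2,5,7)[OF assms(2)] unfolding connected_def by blast
qed

text \<open>
  A connected open set cannot leave a side of the cycle and cannot stop short of filling it, since its
  frontier is the cycle itself.
\<close>

lemma face_eq_side:
  assumes "f \<in> Fs" "cycle_in E vs" "frontier f = cyc_im vs"
  shows "f = inside (cyc_im vs) \<or> f = outside (cyc_im vs)"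
proof -
  have *: "f = S" if "f \<subseteq> S" "connected S" "S \<subseteq> - cyc_im vs" for S
  proof (rule ccontr)
    assume "f \<noteq> S"
    then have "S \<inter> frontier f \<noteq> {}"
      using that face_facts(3)[OF assms(1)] by (intro connected_Int_frontier) auto
    then show False using that assms(3) by auto
  qed
  show ?thesis using face_side[OF assms(1,2)] * jordan_cycle(3,6,8)[OF assms(2)] by blast
qed

text \<open>
  An inner point of the edge that represents the edge in topological arguments: it lies on no other
  edge and is no vertex.
\<close>

definition mid :: "'a set \<Rightarrow> complex" where "mid e = curve e (1/2)"

lemma mid:
  assumes "e \<in> E"
  shows "mid e \<in> im e" "mid e \<notin> pos ` V" "\<And>e'. e' \<in> E \<Longrightarrow> mid e \<in> im e' \<Longrightarrow> e' = e"
proof -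
  show m: "mid e \<in> im e" by (auto simp: mid_def path_image_def)
  have inj: "inj_on (curve e) {0..1}" using curve_arc[OF assms] by (simp add: arc_def)
  have "mid e \<noteq> pathstart (curve e)" "mid e \<noteq> pathfinish (curve e)"
    using inj_onD[OF inj, of "1/2" 0] inj_onD[OF inj, of "1/2" 1]
    unfolding mid_def pathstart_def pathfinish_def by auto
  then have "mid e \<notin> pos ` e" using curve_ends[OF assms] by auto
  then show mV: "mid e \<notin> pos ` V" using curve_vertices[OF assms] m by auto
  show "e' = e" if "e' \<in> E" "mid e \<in> im e'" for e'
    using im_Int[OF that(1) assms _ that(2) m] mV edge_V[OF assms] by blast
qed

end

locale polygonal_plane_graph = plane_graph +
  assumes polygonal: "f \<in> faces V E pos curve \<Longrightarrow> \<exists>k. k_gonal E curve k f"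
begin

lemma face_cycle:
  assumes "f \<in> Fs"
  obtains vs where "cycle_in E vs" "frontier f = cyc_im vs"
  using polygonal[OF assms] unfolding k_gonal_def by blast

lemma face_edges_cycle:
  assumes "cycle_in E vs" "frontier f = cyc_im vs"
  shows "face_edges E curve f = cycle_edges vs"
proof
  have c: "cycle_edges vs \<subseteq> E" using assms by (simp add: cycle_in_def)
  show "cycle_edges vs \<subseteq> face_edges E curve f" using c assms by (auto simp: face_edges_def)
  show "face_edges E curve f \<subseteq> cycle_edges vs"
  proof
    fix e assume "e \<in> face_edges E curve f"
    then have e: "e \<in> E" "im e \<subseteq> cyc_im vs" using assms(2) by (auto simp: face_edges_def)
    then obtain e' where e': "e' \<in> cycle_edges vs" "mid e \<in> im e'" using mid(1)[OF e(1)] by blast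
    then show "e \<in> cycle_edges vs" using mid(3)[OF e(1), of e'] c by auto
  qed
qed

lemma face_edges_mid:
  assumes "f \<in> Fs" "e \<in> E"
  shows "e \<in> face_edges E curve f \<longleftrightarrow> mid e \<in> frontier f"
proof -
  obtain vs where vs: "cycle_in E vs" "frontier f = cyc_im vs" using face_cycle[OF assms(1)] by blast
  show ?thesis
  proof
    show "e \<in> face_edges E curve f \<Longrightarrow> mid e \<in> frontier f" using mid(1)[OF assms(2)] by (auto simp: face_edges_def)
    assume "mid e \<in> frontier f"
    then obtain e' where e': "e' \<in> cycle_edges vs" "mid e \<in> im e'" using vs(2) by blast
    then have "e' = e" using mid(3)[OF assms(2), of e'] vs(1) by (auto simp: cycle_in_def)
    then show "e \<in> face_edges E curve f" using e' face_edges_cycle[OF vs] by simp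
  qed
qed

lemma finite_cycles: "finite {vs. cycle_in E vs}"
proof (rule finite_subset)
  show "{vs. cycle_in E vs} \<subseteq> {vs. set vs \<subseteq> V \<and> length vs \<le> card V}"
  proof clarify
    fix vs assume "cycle_in E vs"
    then have c: "cycle_edges vs \<subseteq> E" "distinct vs" "vs \<noteq> []" by (auto simp: cycle_in_def)
    then have "set vs \<subseteq> V" using Union_cycle_edges[of vs] edge_V by blast
    then show "set vs \<subseteq> V \<and> length vs \<le> card V" using c finite_V by (metis card_mono distinct_card)
  qed
  show "finite {vs. set vs \<subseteq> V \<and> length vs \<le> card V}" using finite_V by (rule finite_lists_length_le)
qed

text \<open>
  There are finitely many cycles, and each of them bounds at most two faces.
\<close>

lemma finite_faces: "finite Fs"
proof (rule finite_subset)
  show "Fs \<subseteq> (\<lambda>vs. inside (cyc_im vs)) ` {vs. cycle_in E vs} \<union> (\<lambda>vs. outside (cyc_im vs)) ` {vs. cycle_in E vs}"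
    using face_cycle face_eq_side by (smt (verit) UnCI image_eqI mem_Collect_eq subsetI)
qed (use finite_cycles in auto)

text \<open>
  The drawing is nowhere dense, so points of faces that meet \<open>S\<close> accumulate at the midpoint; as there
  are finitely many faces, one of them accumulates there by itself.
\<close>

lemma mid_in_frontier_of_face:
  assumes "e \<in> E" "open S" "mid e \<in> closure S"
  shows "\<exists>f\<in>Fs. f \<inter> S \<noteq> {} \<and> e \<in> face_edges E curve f"
proof -
  have "mid e \<in> closure (\<Union>{f \<in> Fs. f \<inter> S \<noteq> {}})"
  proof (subst closure_iff_nhds_not_empty, intro allI impI)
    fix A T assume A: "T \<subseteq> A" "open T" "mid e \<in> T"
    then have "T \<inter> S \<noteq> {}" using assms(3) by (metis closure_iff_nhds_not_empty inf_commute order_refl)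
    moreover have "open (T \<inter> S)" using A assms by auto
    ultimately have "\<not> T \<inter> S \<subseteq> D" using drawing_nowhere_dense by (metis interior_maximal subset_empty)
    then obtain x where "x \<in> T" "x \<in> S" "x \<notin> D" by blast
    then show "\<Union>{f \<in> Fs. f \<inter> S \<noteq> {}} \<inter> A \<noteq> {}" using in_some_face[of x] A by blast
  qed
  moreover have "closure (\<Union>{f \<in> Fs. f \<inter> S \<noteq> {}}) \<subseteq> (\<Union>f\<in>{f \<in> Fs. f \<inter> S \<noteq> {}}. closure f)"
  proof (rule closure_minimal)
    show "closed (\<Union>f\<in>{f \<in> Fs. f \<inter> S \<noteq> {}}. closure f)" using finite_faces by (intro closed_UN) auto
  qed (use closure_subset in blast)
  ultimately have "mid e \<in> (\<Union>f\<in>{f \<in> Fs. f \<inter> S \<noteq> {}}. closure f)" by blast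
  then obtain f where f: "f \<in> Fs" "f \<inter> S \<noteq> {}" "mid e \<in> closure f" by blast
  moreover have "mid e \<notin> f" using mid(1)[OF assms(1)] face_facts(4)[OF f(1)] assms(1) by (auto simp: drawing_def)
  then have "mid e \<in> frontier f" using f face_facts(1)[OF f(1)] by (simp add: frontier_def interior_open)
  ultimately show ?thesis using face_edges_mid[OF f(1) assms(1)] by blast
qed

text \<open>
  Janiszewski's theorem, applied to the cycle \<open>Z\<close> and to the drawing \<open>T\<close> without the interior of the
  edge \<open>e\<close>. Points of \<open>f\<close> and \<open>g\<close> near the midpoint of \<open>e\<close> are separated neither by \<open>Z\<close>, as they
  lie on the same side, nor by \<open>T\<close>, as a small disc around the midpoint avoids \<open>T\<close>. Since
  \<open>Z \<inter> T\<close> is the rest of the cycle, an arc and thus connected, the whole drawing does not separate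
  them.
\<close>

lemma face_on_same_side_unique:
  assumes cyc: "cycle_in E vs" "e \<in> cycle_edges vs"
    and fg: "f \<in> Fs" "g \<in> Fs" "e \<in> face_edges E curve f" "e \<in> face_edges E curve g"
    and side: "S = inside (cyc_im vs) \<or> S = outside (cyc_im vs)" "f \<subseteq> S" "g \<subseteq> S"
  shows "f = g"
proof -
  obtain ws where ws: "cycle_in E ws" "cycle_edges ws = cycle_edges vs" "e = {last ws, hd ws}"
    by (rule cycle_in_closing_edge[OF cyc]) (rule that)
  obtain p where p: "arc p" "pathstart p = pos (hd ws)" "pathfinish p = pos (last ws)"
    "path_image p = (\<Union>e'\<in>cycle_edges ws - {e}. im e')"
    by (rule cycle_closing_arc[OF ws(1,3)]) (rule that)
  have cE: "cycle_edges ws \<subseteq> E" using ws by (simp add: cycle_in_def)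
  have eE: "e \<in> E" using cE ws cyc by auto
  define T where "T = pos ` V \<union> (\<Union>e'\<in>E - {e}. im e')"
  define Z where "Z = cyc_im vs"
  have T: "closed T" unfolding T_def
    using finite_V finite_E closed_im by (intro closed_Un closed_UN finite_imp_closed) auto
  have Z: "compact Z" unfolding Z_def
    using cycle_loop[OF cyc(1)] compact_simple_path_image by metis
  have ends: "pos ` e \<subseteq> path_image p" using p ws(3) pathstart_in_path_image[of p] pathfinish_in_path_image[of p] by auto
  have ZT: "Z \<inter> T = path_image p"
  proof
    show "Z \<inter> T \<subseteq> path_image p"
    proof
      fix x assume x: "x \<in> Z \<inter> T"
      then obtain e1 where e1: "e1 \<in> cycle_edges ws" "x \<in> im e1" unfolding Z_def ws(2) by blast
      show "x \<in> path_image p"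
      proof (cases "e1 = e")
        case False then show ?thesis using e1 p by auto
      next
        case True
        have "x \<in> pos ` e"
        proof -
          from x consider "x \<in> pos ` V" | e' where "e' \<in> E" "e' \<noteq> e" "x \<in> im e'" unfolding T_def by blast
          then show ?thesis
          proof cases
            case 1 then show ?thesis using curve_vertices[OF eE] e1 True by auto
          next
            case 2 then show ?thesis using im_Int[of e' e x] e1 True eE by auto
          qed
        qed
        then show ?thesis using ends by blast
      qed
    qed
    show "path_image p \<subseteq> Z \<inter> T" unfolding p(4) Z_def T_def using cE ws(2) by blast
  qed
  have con: "connected (Z \<inter> T)" unfolding ZT using p(1) by (simp add: connected_arc_image)
  have "mid e \<notin> T" unfolding T_def using mid[OF eE] by blast
  then obtain r where r: "r > 0" "ball (mid e) r \<subseteq> - T" using T by (metis ComplI openE open_Compl)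
  have mf: "mid e \<in> closure f" "mid e \<in> closure g"
    using face_edges_mid fg eE by (auto simp: frontier_def)
  obtain a where a: "a \<in> f" "a \<in> ball (mid e) r" using mf(1) r by (metis closure_approachable dist_commute mem_ball)
  obtain b where b: "b \<in> g" "b \<in> ball (mid e) r" using mf(2) r by (metis closure_approachable dist_commute mem_ball)
  have "connected_component (- T) a b"
    unfolding connected_component_def using a b r by (intro exI[of _ "ball (mid e) r"]) auto
  moreover have "connected_component (- Z) a b"
  proof -
    have "connected S" "S \<subseteq> - Z" using side(1) jordan_cycle(3,6,8)[OF cyc(1)] unfolding Z_def by blast+
    then show ?thesis unfolding connected_component_def using a b side by blast
  qed
  ultimately have "connected_component (- (Z \<union> T)) a b" using Janiszewski[OF Z T con] by blast
  moreover have "Z \<union> T = D"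
    unfolding T_def Z_def drawing_def using eE cyc(2) cE ws(2) by blast
  ultimately have "connected_component (- D) a b" by simp
  then obtain C where C: "connected C" "C \<subseteq> - D" "a \<in> C" "b \<in> C" unfolding connected_component_def by blast
  have "C \<subseteq> f" using C fg(1) a components_maximal[of f "- D" C] unfolding faces_def by blast
  then show ?thesis using C(4) b fg faces_disjoint by blast
qed

text \<open>
  Each point of the cycle is a limit of points on both sides, by the Jordan curve theorem; this gives
  one face on either side, and by the preceding lemma only one.
\<close>

lemma cycle_edge_two_sides:
  assumes "cycle_in E vs" "e \<in> cycle_edges vs"
  obtains f g where "f \<in> Fs" "f \<subseteq> inside (cyc_im vs)" "g \<in> Fs" "g \<subseteq> outside (cyc_im vs)"
    "{h \<in> Fs. e \<in> face_edges E curve h} = {f, g}" "f \<noteq> g"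
proof -
  have eE: "e \<in> E" using assms by (auto simp: cycle_in_def)
  have "mid e \<in> cyc_im vs" using mid(1)[OF eE] assms by auto
  then have cl: "mid e \<in> closure (inside (cyc_im vs))" "mid e \<in> closure (outside (cyc_im vs))"
    using jordan_cycle(9,10)[OF assms(1)] by (auto simp: frontier_def)
  note J = jordan_cycle[OF assms(1)]
  obtain f where f: "f \<in> Fs" "f \<inter> inside (cyc_im vs) \<noteq> {}" "e \<in> face_edges E curve f"
    using mid_in_frontier_of_face[OF eE J(2) cl(1)] by blast
  obtain g where g: "g \<in> Fs" "g \<inter> outside (cyc_im vs) \<noteq> {}" "e \<in> face_edges E curve g"
    using mid_in_frontier_of_face[OF eE J(5) cl(2)] by blast
  have fs: "f \<subseteq> inside (cyc_im vs)" using face_side[OF f(1) assms(1)] f J(7) by blast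
  have gs: "g \<subseteq> outside (cyc_im vs)" using face_side[OF g(1) assms(1)] g J(7) by blast
  have "h \<in> {f, g}" if "h \<in> Fs" "e \<in> face_edges E curve h" for h
    using face_side[OF that(1) assms(1)] face_on_same_side_unique[OF assms that(1) f(1) that(2) f(3)]
      face_on_same_side_unique[OF assms that(1) g(1) that(2) g(3)] fs gs by blast
  moreover have "f \<noteq> g" using fs gs J(7) face_facts(3)[OF f(1)] by blast
  ultimately show ?thesis using that[of f g] f g fs gs by blast
qed

lemma edge_in_two_faces:
  assumes "e \<in> E" shows "card {f \<in> Fs. e \<in> face_edges E curve f} = 2"
proof -
  obtain f where f: "f \<in> Fs" "e \<in> face_edges E curve f"
    using mid_in_frontier_of_face[OF assms, of UNIV] by auto
  obtain vs where vs: "cycle_in E vs" "frontier f = cyc_im vs" using face_cycle[OF f(1)] by blast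
  then have "e \<in> cycle_edges vs" using face_edges_cycle f by blast
  then obtain g h where "g \<in> Fs" "g \<subseteq> inside (cyc_im vs)" "h \<in> Fs" "h \<subseteq> outside (cyc_im vs)"
    "{h \<in> Fs. e \<in> face_edges E curve h} = {g, h}" "g \<noteq> h"
    by (rule cycle_edge_two_sides[OF vs(1)])
  then show ?thesis by (simp add: card_2_iff)
qed

text \<open>
  The separating set consists of the faces inside the cycle.
\<close>

lemma cycle_separates_faces:
  assumes cyc: "cycle_in E vs"
  shows "\<exists>S\<subseteq>Fs. \<forall>e\<in>E. e \<in> cycle_edges vs \<longleftrightarrow>
           (\<exists>f\<in>S. \<exists>g\<in>Fs - S. e \<in> face_edges E curve f \<and> e \<in> face_edges E curve g)"
proof (intro exI[of _ "{f \<in> Fs. f \<subseteq> inside (cyc_im vs)}"] conjI ballI iffI)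
  note J = jordan_cycle[OF cyc]
  let ?S = "{f \<in> Fs. f \<subseteq> inside (cyc_im vs)}"
  fix e assume eE: "e \<in> E"
  {
    assume "e \<in> cycle_edges vs"
    then obtain f g where fg: "f \<in> Fs" "f \<subseteq> inside (cyc_im vs)" "g \<in> Fs" "g \<subseteq> outside (cyc_im vs)"
      "{h \<in> Fs. e \<in> face_edges E curve h} = {f, g}" "f \<noteq> g"
      by (rule cycle_edge_two_sides[OF cyc])
    have "\<not> g \<subseteq> inside (cyc_im vs)"
    proof
      assume "g \<subseteq> inside (cyc_im vs)"
      then have "g \<subseteq> {}" using fg(4) J(7) by (metis Int_greatest)
      then show False using face_facts(3)[OF fg(3)] by simp
    qed
    then have "g \<in> Fs - ?S" "f \<in> ?S" using fg(1-3) by simp_all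
    moreover have "e \<in> face_edges E curve f" "e \<in> face_edges E curve g" using fg(5) by blast+
    ultimately show "\<exists>f\<in>?S. \<exists>g\<in>Fs - ?S. e \<in> face_edges E curve f \<and> e \<in> face_edges E curve g"
      by meson
  next
    assume "\<exists>f\<in>?S. \<exists>g\<in>Fs - ?S. e \<in> face_edges E curve f \<and> e \<in> face_edges E curve g"
    then obtain f g where fg: "f \<in> Fs" "f \<subseteq> inside (cyc_im vs)" "g \<in> Fs" "\<not> g \<subseteq> inside (cyc_im vs)"
      "mid e \<in> closure f" "mid e \<in> closure g" using face_edges_mid eE by (auto simp: frontier_def)
    then have gs: "g \<subseteq> outside (cyc_im vs)" using face_side[OF fg(3) cyc] by blast
    show "e \<in> cycle_edges vs"
    proof (rule ccontr)
      assume "e \<notin> cycle_edges vs"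
      then have "mid e \<notin> cyc_im vs" using mid(3)[OF eE] cyc unfolding cycle_in_def by blast
      then consider "mid e \<in> inside (cyc_im vs)" | "mid e \<in> outside (cyc_im vs)" using J(8) by blast
      then show False
      proof cases
        case 1
        then have "inside (cyc_im vs) \<inter> g \<noteq> {}" using fg(6) J(2) by (meson closure_iff_nhds_not_empty disjoint_iff order_refl)
        then show False using gs J(7) by blast
      next
        case 2
        then have "outside (cyc_im vs) \<inter> f \<noteq> {}" using fg(5) J(5) by (meson closure_iff_nhds_not_empty disjoint_iff order_refl)
        then show False using fg J(7) by blast
      qed
    qed
  }
qed auto

end

section \<open>Polyhedral maps with pentagons and hexagons\<close>

lemma double_count:
  assumes "finite A" "finite B"
  shows "(\<Sum>a\<in>A. card {b \<in> B. R a b}) = (\<Sum>b\<in>B. card {a \<in> A. R a b})"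
proof -
  have "(\<Sum>a\<in>A. card {b \<in> B. R a b}) = (\<Sum>a\<in>A. \<Sum>b\<in>B. if R a b then 1 else 0)"
    using assms by (simp add: sum.If_cases Int_def)
  also have "\<dots> = (\<Sum>b\<in>B. \<Sum>a\<in>A. if R a b then 1 else 0)" by (rule sum.swap)
  also have "\<dots> = (\<Sum>b\<in>B. card {a \<in> A. R a b})"
    using assms by (simp add: sum.If_cases Int_def)
  finally show ?thesis .
qed

text \<open>
  The combinatorial content of a plane cubic graph with pentagonal and hexagonal faces. The
  last axiom is planarity: every cycle is the boundary modulo 2 of a set of faces.
\<close>

locale polyhedral_map =
  fixes V :: "'a set" and E :: "'a set set" and F :: "'f set" and bd :: "'f \<Rightarrow> 'a set set"
  assumes graph: "simple_graph V E" and is_cubic: "cubic V E" and connected3: "three_connected V E"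
    and finite_F: "finite F"
    and face_cycle: "f \<in> F \<Longrightarrow> \<exists>vs. cycle_in E vs \<and> (length vs = 5 \<or> length vs = 6) \<and> bd f = cycle_edges vs"
    and two_faces: "e \<in> E \<Longrightarrow> card {f \<in> F. e \<in> bd f} = 2"
    and cycle_boundary: "cycle_in E vs \<Longrightarrow>
      \<exists>S\<subseteq>F. \<forall>e\<in>E. e \<in> cycle_edges vs \<longleftrightarrow> (\<exists>f\<in>S. \<exists>g\<in>F - S. e \<in> bd f \<and> e \<in> bd g)"
begin

definition fv :: "'f \<Rightarrow> 'a set" where "fv f = \<Union>(bd f)"

definition cut :: "'a set \<Rightarrow> 'a set set" where "cut X = {e \<in> E. e \<inter> X \<noteq> {} \<and> \<not> e \<subseteq> X}"

abbreviation inner :: "'a set \<Rightarrow> 'a set set" where "inner X \<equiv> induced_edges E X"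

lemma finite_V: "finite V" and edge_V: "e \<in> E \<Longrightarrow> e \<subseteq> V" and edge_card: "e \<in> E \<Longrightarrow> card e = 2"
  using graph by (auto simp: simple_graph_def)

lemma finite_E: "finite E"
  by (meson PowI edge_V finite_Pow_iff finite_V finite_subset subsetI)

lemma finite_cut [simp]: "finite (cut X)" and finite_inner [simp]: "finite (inner X)"
  using finite_E by (auto simp: cut_def induced_edges_def)

lemma edge_neq: "{a, b} \<in> E \<Longrightarrow> a \<noteq> b"
  using edge_card by fastforce

lemma edge_in_V: "{a, b} \<in> E \<Longrightarrow> a \<in> V \<and> b \<in> V"
  using edge_V by blast

lemma edge_at:
  assumes "e \<in> E" "v \<in> e" obtains w where "e = {v, w}" "v \<noteq> w"
proof -
  obtain a b where "e = {a, b}" "a \<noteq> b" using edge_card[OF assms(1)] by (auto simp: card_2_iff)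
  then show ?thesis using that assms(2) by (cases "v = a") (auto simp: insert_commute)
qed

lemma card_incident:
  assumes "v \<in> V" shows "card {e \<in> E. v \<in> e} = 3"
proof -
  have "{e \<in> E. v \<in> e} = (\<lambda>w. {v, w}) ` nbrs E v"
  proof
    show "{e \<in> E. v \<in> e} \<subseteq> (\<lambda>w. {v, w}) ` nbrs E v"
    proof
      fix e assume "e \<in> {e \<in> E. v \<in> e}"
      then have e: "e \<in> E" "v \<in> e" by auto
      then obtain w where "e = {v, w}" by (rule edge_at)
      then show "e \<in> (\<lambda>w. {v, w}) ` nbrs E v" using e by (auto simp: nbrs_def)
    qed
  qed (auto simp: nbrs_def)
  moreover have "inj_on (\<lambda>w. {v, w}) (nbrs E v)"
    by (auto simp: inj_on_def doubleton_eq_iff)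
  ultimately show ?thesis using is_cubic assms by (simp add: card_image cubic_def)
qed

lemma incidence_count:
  assumes "H \<subseteq> E" "finite X"
  shows "(\<Sum>v\<in>X. card {e \<in> H. v \<in> e}) = 2 * card (H \<inter> inner X) + card (H \<inter> cut X)"
proof -
  have fH: "finite H" using assms finite_E finite_subset by blast
  have *: "card {v \<in> X. v \<in> e} = (if e \<subseteq> X then 2 else 0) + (if e \<in> cut X then 1 else 0)" if "e \<in> H" for e
  proof -
    have eE: "e \<in> E" using that assms by blast
    have 2: "card e = 2" by (rule edge_card[OF eE])
    have i: "{v \<in> X. v \<in> e} = e \<inter> X" by blast
    consider "e \<subseteq> X" | "e \<inter> X = {}" | "e \<in> cut X" "\<not> e \<subseteq> X" "e \<inter> X \<noteq> {}" using eE unfolding cut_def by blast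
    then show ?thesis
    proof cases
      case 1 then have "e \<inter> X = e" "e \<notin> cut X" unfolding cut_def by auto
      then show ?thesis using 2 1 i by simp
    next
      case 2
      moreover have "e \<noteq> {}" using \<open>card e = 2\<close> by auto
      ultimately have "\<not> e \<subseteq> X" "e \<notin> cut X" unfolding cut_def by blast+
      then show ?thesis using 2 unfolding i by simp
    next
      case 3
      have fe: "finite e" using 2 card.infinite by fastforce
      have "card (e \<inter> X) < card e" using 3 fe by (intro psubset_card_mono) auto
      moreover have "card (e \<inter> X) > 0" using 3 fe by (simp add: card_gt_0_iff)
      ultimately show ?thesis using 2 3 i by simp
    qed
  qed
  have "(\<Sum>v\<in>X. card {e \<in> H. v \<in> e}) = (\<Sum>e\<in>H. card {v \<in> X. v \<in> e})"
    by (rule double_count[OF assms(2) fH])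
  also have "\<dots> = (\<Sum>e\<in>H. (if e \<subseteq> X then 2 else 0) + (if e \<in> cut X then 1 else 0))"
    by (rule sum.cong) (use * in auto)
  also have "\<dots> = 2 * card {e \<in> H. e \<subseteq> X} + card (H \<inter> cut X)"
    using fH by (simp add: sum.distrib sum.If_cases Int_def)
  also have "{e \<in> H. e \<subseteq> X} = H \<inter> inner X" using assms by (auto simp: induced_edges_def)
  finally show ?thesis .
qed

lemma degree_sum:
  assumes "X \<subseteq> V"
  shows "3 * card X = 2 * card (inner X) + card (cut X)"
proof -
  have "(\<Sum>v\<in>X. card {e \<in> E. v \<in> e}) = 2 * card (E \<inter> inner X) + card (E \<inter> cut X)"
    using assms finite_V finite_subset by (intro incidence_count) auto
  moreover have "(\<Sum>v\<in>X. card {e \<in> E. v \<in> e}) = (\<Sum>v\<in>X. 3)"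
    by (rule sum.cong) (use card_incident assms in auto)
  moreover have "E \<inter> inner X = inner X" "E \<inter> cut X = cut X" by (auto simp: induced_edges_def cut_def)
  ultimately show ?thesis by simp
qed

lemma cut_compl: "X \<subseteq> V \<Longrightarrow> cut (V - X) = cut X"
  unfolding cut_def using edge_V by blast

subsection \<open>Faces\<close>

lemma bd_E: "f \<in> F \<Longrightarrow> bd f \<subseteq> E"
  using face_cycle unfolding cycle_in_def by blast

lemma face_list:
  assumes "f \<in> F"
  obtains vs where "cycle_in E vs" "length vs = 5 \<or> length vs = 6" "bd f = cycle_edges vs" "fv f = set vs"
proof -
  obtain vs where vs: "cycle_in E vs" "length vs = 5 \<or> length vs = 6" "bd f = cycle_edges vs"
    using face_cycle[OF assms] by blast
  then have "vs \<noteq> []" by auto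
  then have "fv f = set vs" using Union_cycle_edges vs unfolding fv_def by simp
  then show ?thesis using that vs by blast
qed

lemma fv_V: "f \<in> F \<Longrightarrow> fv f \<subseteq> V"
  unfolding fv_def using bd_E edge_V by blast

lemma finite_fv: "f \<in> F \<Longrightarrow> finite (fv f)"
  using fv_V finite_V finite_subset by blast

lemma card_fv: "f \<in> F \<Longrightarrow> card (fv f) = 5 \<or> card (fv f) = 6"
proof -
  assume "f \<in> F"
  then obtain vs where "cycle_in E vs" "length vs = 5 \<or> length vs = 6" "bd f = cycle_edges vs" "fv f = set vs"
    by (rule face_list)
  then show ?thesis by (simp add: cycle_in_def distinct_card)
qed

lemma face_degree:
  assumes "f \<in> F" "v \<in> fv f"
  shows "card {e \<in> bd f. v \<in> e} = 2"
proof -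
  obtain vs where vs: "cycle_in E vs" "length vs = 5 \<or> length vs = 6" "bd f = cycle_edges vs" "fv f = set vs"
    using assms(1) by (rule face_list)
  have "v \<in> set vs" using vs assms by simp
  then obtain w zs where z: "cycle_in E (v # w # zs)" "zs \<noteq> []" "length (v # w # zs) = length vs"
    "cycle_edges (v # w # zs) = cycle_edges vs" "set (v # w # zs) = set vs"
    by (rule cycle_in_from[OF vs(1)])
  have d: "distinct (v # w # zs)" using z by (simp add: cycle_in_def)
  have "{e \<in> bd f. v \<in> e} = {{v, w}, {v, last zs}}" using cycle_edges_at_hd[OF d z(2)] z vs by simp
  moreover have "w \<noteq> last zs" using d z(2) by auto
  ultimately show ?thesis by (auto simp: card_insert_if doubleton_eq_iff)
qed

lemma bd_fv: "e \<in> bd f \<Longrightarrow> e \<subseteq> fv f"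
  by (auto simp: fv_def)

lemma face_count:
  assumes "f \<in> F" "X \<subseteq> V"
  shows "2 * card (fv f \<inter> X) = 2 * card (bd f \<inter> inner X) + card (bd f \<inter> cut X)"
proof -
  have fX: "finite X" using assms finite_V finite_subset by blast
  have "(\<Sum>v\<in>X. card {e \<in> bd f. v \<in> e}) = 2 * card (bd f \<inter> inner X) + card (bd f \<inter> cut X)"
    by (rule incidence_count[OF bd_E[OF assms(1)] fX])
  moreover have "(\<Sum>v\<in>X. card {e \<in> bd f. v \<in> e}) = (\<Sum>v\<in>X. if v \<in> fv f then 2 else 0)"
  proof (rule sum.cong)
    fix v
    have "{e \<in> bd f. v \<in> e} = {}" if "v \<notin> fv f" using that by (auto simp: fv_def)
    then show "card {e \<in> bd f. v \<in> e} = (if v \<in> fv f then 2 else 0)"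
      using face_degree[OF assms(1)] by (metis card.empty)
  qed simp
  moreover have "\<dots> = 2 * card (fv f \<inter> X)" using fX by (simp add: sum.If_cases Int_commute)
  ultimately show ?thesis by simp
qed

lemma card_bd:
  assumes "f \<in> F" shows "card (bd f) = card (fv f)"
proof -
  have "bd f \<inter> inner (fv f) = bd f" "bd f \<inter> cut (fv f) = {}"
    using bd_fv bd_E[OF assms] by (auto simp: induced_edges_def cut_def)
  then show ?thesis using face_count[OF assms fv_V[OF assms]] by simp
qed

text \<open>At a vertex three edges meet, and a face through the vertex uses two of them.\<close>

lemma faces_at_vertex_share_edge:
  assumes "v \<in> V" "f \<in> F" "g \<in> F" "v \<in> fv f" "v \<in> fv g"
  shows "\<exists>e\<in>bd f \<inter> bd g. v \<in> e"
proof (rule ccontr)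
  assume "\<not> ?thesis"
  then have dis: "{e \<in> bd f. v \<in> e} \<inter> {e \<in> bd g. v \<in> e} = {}" by blast
  have sub: "{e \<in> bd f. v \<in> e} \<union> {e \<in> bd g. v \<in> e} \<subseteq> {e \<in> E. v \<in> e}" using bd_E assms by blast
  have fin: "finite {e \<in> E. v \<in> e}" using finite_E by simp
  have "card ({e \<in> bd f. v \<in> e} \<union> {e \<in> bd g. v \<in> e}) = 4"
    using dis face_degree assms finite_subset[OF _ fin] sub by (subst card_Un_disjoint) auto
  then show False using card_mono[OF fin sub] card_incident[OF assms(1)] by simp
qed

lemma edge_face_pair:
  assumes "e \<in> E"
  obtains f g where "f \<in> F" "g \<in> F" "f \<noteq> g" "{h \<in> F. e \<in> bd h} = {f, g}"
proof -
  obtain f g where "{h \<in> F. e \<in> bd h} = {f, g}" "f \<noteq> g"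
    using two_faces[OF assms] by (auto simp: card_2_iff)
  then show ?thesis using that[of f g] by blast
qed

text \<open>
  The three edges at a vertex have six incidences with faces, and a face through the vertex uses
  two of the edges. If no face used both \<open>e1\<close> and \<open>e2\<close>, the two faces at \<open>e1\<close> and also those at \<open>e2\<close>
  would contain the third edge, which lies on two faces only.
\<close>

lemma edges_at_vertex_share_face:
  assumes v: "v \<in> V" and e: "e1 \<in> E" "e2 \<in> E" "v \<in> e1" "v \<in> e2"
  shows "\<exists>f\<in>F. e1 \<in> bd f \<and> e2 \<in> bd f"
proof (rule ccontr)
  assume no: "\<not> ?thesis"
  obtain f g where fg: "f \<in> F" "g \<in> F" "f \<noteq> g" "{h \<in> F. e1 \<in> bd h} = {f, g}"
    using e(1) by (rule edge_face_pair)
  have ne: "e1 \<noteq> e2" using no fg by blast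
  have "{e1, e2} \<subseteq> {e \<in> E. v \<in> e}" using e by blast
  then have "card ({e \<in> E. v \<in> e} - {e1, e2}) = 1" using card_incident[OF v] ne by (simp add: card_Diff_subset)
  then obtain e3 where "{e \<in> E. v \<in> e} - {e1, e2} = {e3}" by (auto simp: card_1_singleton_iff)
  then have all: "{e \<in> E. v \<in> e} = {e1, e2, e3}" and e3: "e3 \<in> E" "e3 \<noteq> e1" "e3 \<noteq> e2" using e by blast+
  have two: "{e \<in> bd h. v \<in> e} = {d, e3}" if "h \<in> F" "d \<in> bd h" "d' \<notin> bd h" "{d, d'} = {e1, e2}" for h d d'
  proof (rule card_subset_eq)
    have "{e \<in> bd h. v \<in> e} \<subseteq> {e1, e2, e3}" using all bd_E[OF that(1)] by blast
    then show "{e \<in> bd h. v \<in> e} \<subseteq> {d, e3}" using that by (auto simp: doubleton_eq_iff)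
    have "v \<in> d" using that e by (auto simp: doubleton_eq_iff)
    then have "v \<in> fv h" using that by (auto simp: fv_def)
    then have "card {e \<in> bd h. v \<in> e} = 2" using face_degree that by blast
    moreover have "d \<noteq> e3" using that e3 by (auto simp: doubleton_eq_iff)
    ultimately show "card {e \<in> bd h. v \<in> e} = card {d, e3}" by simp
  qed simp
  have in1: "e1 \<in> bd f" "e1 \<in> bd g" using fg(4) by blast+
  then have no1: "e2 \<notin> bd f" "e2 \<notin> bd g" using no fg by blast+
  have "e3 \<in> bd f" "e3 \<in> bd g"
    using two[OF fg(1) in1(1) no1(1) refl] two[OF fg(2) in1(2) no1(2) refl] by blast+
  then have "{f, g} \<subseteq> {h \<in> F. e3 \<in> bd h}" using fg by blast
  moreover have "card {f, g} = card {h \<in> F. e3 \<in> bd h}" using two_faces[OF e3(1)] fg(3) by simp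
  ultimately have f3: "{h \<in> F. e3 \<in> bd h} = {f, g}"
    using finite_F card_subset_eq[of "{h \<in> F. e3 \<in> bd h}" "{f, g}"] by simp
  obtain h where h: "h \<in> F" "e2 \<in> bd h" using edge_face_pair[OF e(2)] by blast
  then have "e1 \<notin> bd h" using no by blast
  then have "e3 \<in> bd h" using two[OF h _ insert_commute] by blast
  then have "h \<in> {f, g}" using f3 h by blast
  then show False using no h in1 by blast
qed

subsection \<open>Small edge cuts\<close>

text \<open>
  For three or more vertices, deleting the end in \<open>X\<close> of each cut edge leaves something of \<open>X\<close>, and
  with fewer than three cut edges this contradicts 3-connectedness. One or two vertices are handled by
  counting degrees.
\<close>

lemma cut_ge_3:
  assumes X: "X \<subseteq> V" "X \<noteq> {}" "X \<noteq> V"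
  shows "3 \<le> card (cut X)"
proof (cases "card X \<ge> 3")
  case False
  have fX: "finite X" using X finite_V finite_subset by blast
  then have cX: "card X > 0" using X by (simp add: card_gt_0_iff)
  have "inner X \<subseteq> {X}"
  proof
    fix e assume "e \<in> inner X"
    then have "e \<subseteq> X" "card e = 2" using edge_card by (auto simp: induced_edges_def)
    then show "e \<in> {X}" using False fX by (metis card_mono card_subset_eq insertI1 le_antisym not_less_eq_eq numeral_2_eq_2 numeral_3_eq_3)
  qed
  then have i1: "card (inner X) \<le> 1" using card_mono[of "{X}"] by simp
  show ?thesis
  proof (cases "card X = 1")
    case True
    have "inner X = {}"
    proof (rule equals0I)
      fix e assume "e \<in> inner X"
      then have "e \<subseteq> X" "card e = 2" using edge_card by (auto simp: induced_edges_def)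
      then show False using True fX card_mono[of X e] by simp
    qed
    then show ?thesis using degree_sum[OF X(1)] True by simp
  next
    case F2: False
    then have "card X = 2" using False cX by linarith
    then show ?thesis using degree_sum[OF X(1)] i1 by linarith
  qed
next
  case True
  show ?thesis
  proof (rule ccontr)
    assume small: "\<not> 3 \<le> card (cut X)"
    define S where "S = \<Union>(cut X) \<inter> X"
    have "S = \<Union>((\<lambda>e. e \<inter> X) ` cut X)" by (auto simp: S_def)
    then have "card S \<le> (\<Sum>e\<in>cut X. card (e \<inter> X))" by (metis card_UN_le finite_cut)
    also have "\<dots> \<le> (\<Sum>e\<in>cut X. 1)"
    proof (rule sum_mono)
      fix e assume e: "e \<in> cut X"
      then have "card e = 2" using edge_card by (simp add: cut_def)
      moreover have "finite e" using \<open>card e = 2\<close> card.infinite by fastforce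
      moreover have "e \<inter> X \<subset> e" using e by (auto simp: cut_def)
      ultimately have "card (e \<inter> X) < 2" by (metis psubset_card_mono)
      then show "card (e \<inter> X) \<le> 1" by simp
    qed
    finally have cS: "card S < 3" using small by simp
    have "S \<subseteq> X" by (auto simp: S_def)
    then have "S \<subseteq> V" using X by blast
    then have con: "connected_graph (V - S) (induced_edges E (V - S))"
      using connected3 cS unfolding three_connected_def by blast
    have "X - S \<noteq> {}" using True cS \<open>S \<subseteq> X\<close> by (metis Diff_eq_empty_iff linorder_not_le subset_antisym)
    then obtain u where u: "u \<in> X" "u \<notin> S" by blast
    obtain w where w: "w \<in> V" "w \<notin> X" using X by blast
    let ?R = "{(x, y). x \<in> V - S \<and> y \<in> V - S \<and> {x, y} \<in> induced_edges E (V - S)}"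
    have "(u, w) \<in> ?R\<^sup>*" using con u w X \<open>S \<subseteq> X\<close> unfolding connected_graph_def by blast
    then have "w \<in> X"
    proof (induction rule: rtrancl_induct)
      case base then show ?case using u by simp
    next
      case (step y z)
      then have yz: "y \<notin> S" "{y, z} \<in> E" "y \<in> X" by (auto simp: induced_edges_def)
      show ?case
      proof (rule ccontr)
        assume "z \<notin> X"
        then have "{y, z} \<in> cut X" using yz by (auto simp: cut_def)
        then have "y \<in> S" using yz unfolding S_def by blast
        then show False using yz by blast
      qed
    qed
    then show False using w by blast
  qed
qed

text \<open>Two components of a side would each need three of the at most five cut edges.\<close>

lemma small_cut_connected:
  assumes X: "X \<subseteq> V" "card (cut X) \<le> 5" and A: "A \<subseteq> X" "A \<noteq> {}" "A \<noteq> X"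
  shows "\<exists>e\<in>E. e \<subseteq> X \<and> e \<inter> A \<noteq> {} \<and> \<not> e \<subseteq> A"
proof (rule ccontr)
  assume no: "\<not> ?thesis"
  have 1: "cut A \<subseteq> cut X" using no A unfolding cut_def by blast
  have 2: "cut (X - A) \<subseteq> cut X" using no A unfolding cut_def by blast
  have "cut A \<inter> cut (X - A) = {}"
  proof (rule equals0I)
    fix e assume "e \<in> cut A \<inter> cut (X - A)"
    then have e: "e \<in> E" "e \<inter> A \<noteq> {}" "e \<inter> (X - A) \<noteq> {}" by (auto simp: cut_def)
    then obtain a where a: "a \<in> e" "a \<in> A" by blast
    obtain b where b: "e = {a, b}" by (rule edge_at[OF e(1) a(1)])
    then have "e \<subseteq> X" "\<not> e \<subseteq> A" using e a A by auto
    then show False using no e by blast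
  qed
  then have "card (cut A) + card (cut (X - A)) = card (cut A \<union> cut (X - A))"
    by (simp add: card_Un_disjoint)
  also have "\<dots> \<le> card (cut X)" using 1 2 by (intro card_mono) auto
  finally have "card (cut A) + card (cut (X - A)) \<le> 5" using X by simp
  moreover have "3 \<le> card (cut A)" using A X by (intro cut_ge_3) auto
  moreover have "3 \<le> card (cut (X - A))" using A X by (intro cut_ge_3) auto
  ultimately show False by linarith
qed

subsection \<open>Counting the faces inside a side of a small cut\<close>

text \<open>
  The boundary modulo 2 of a set of faces.
\<close>

definition bdry :: "'f set \<Rightarrow> 'a set set" where
  "bdry S = {e \<in> E. \<exists>f\<in>S. \<exists>g\<in>F - S. e \<in> bd f \<and> e \<in> bd g}"

lemma bdry_pair:
  assumes "e \<in> E" "{h \<in> F. e \<in> bd h} = {f, g}" "S \<subseteq> F"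
  shows "e \<in> bdry S \<longleftrightarrow> (f \<in> S) \<noteq> (g \<in> S)"
proof -
  have h: "h \<in> F \<and> e \<in> bd h \<longleftrightarrow> h = f \<or> h = g" for h using assms(2) by blast
  then have "(\<exists>f'\<in>S. \<exists>g'\<in>F - S. e \<in> bd f' \<and> e \<in> bd g') \<longleftrightarrow> (f \<in> S) \<noteq> (g \<in> S)"
    using assms(3) by (metis DiffE DiffI subsetD)
  then show ?thesis using assms(1) unfolding bdry_def by simp
qed

lemma bdry_compl: "S \<subseteq> F \<Longrightarrow> bdry (F - S) = bdry S"
  unfolding bdry_def by blast

text \<open>
  Let \<open>S\<close> be one of the two sets of faces separated by the cycle. No edge at a vertex outside
  \<open>X\<close> is on the cycle, so all faces at such a vertex agree on membership in \<open>S\<close>. The complement of \<open>X\<close>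
  is connected, hence all faces that leave \<open>X\<close> agree, and either \<open>S\<close> or its complement consists of
  faces inside \<open>X\<close>.
\<close>

lemma cycle_bounds_inner_faces:
  assumes X: "X \<subseteq> V" "card (cut X) \<le> 5" and c: "cycle_in E vs" "cycle_edges vs \<subseteq> inner X"
  shows "\<exists>S\<subseteq>{f \<in> F. fv f \<subseteq> X}. bdry S = cycle_edges vs"
proof -
  obtain S where S: "S \<subseteq> F" "\<forall>e\<in>E. e \<in> cycle_edges vs \<longleftrightarrow> (\<exists>f\<in>S. \<exists>g\<in>F - S. e \<in> bd f \<and> e \<in> bd g)"
    using cycle_boundary[OF c(1)] by blast
  have "cycle_edges vs \<subseteq> E" using c(1) by (simp add: cycle_in_def)
  then have bS: "bdry S = cycle_edges vs" using S(2) unfolding bdry_def by blast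
  define Y where "Y = V - X"
  define A where "A = {y \<in> Y. \<forall>f\<in>F. y \<in> fv f \<longrightarrow> f \<in> S}"
  have Y: "Y \<subseteq> V" "card (cut Y) \<le> 5" using X cut_compl unfolding Y_def by auto
  have same: "f \<in> S \<longleftrightarrow> g \<in> S" if y: "y \<in> Y" "f \<in> F" "g \<in> F" "y \<in> fv f" "y \<in> fv g" for y f g
  proof -
    have "y \<in> V" using y Y by blast
    then obtain e where e: "e \<in> bd f" "e \<in> bd g" "y \<in> e" using faces_at_vertex_share_edge[OF _ y(2-5)] by blast
    then have "e \<notin> bdry S" using bS c(2) y by (auto simp: induced_edges_def Y_def)
    then show ?thesis using e y bd_E unfolding bdry_def by blast
  qed
  have "A = {} \<or> A = Y"
  proof (rule ccontr)
    assume "\<not> ?thesis"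
    then obtain e where e: "e \<in> E" "e \<subseteq> Y" "e \<inter> A \<noteq> {}" "\<not> e \<subseteq> A"
      using small_cut_connected[OF Y, of A] unfolding A_def by blast
    obtain f where f: "f \<in> F" "e \<in> bd f" using edge_face_pair[OF e(1)] by blast
    obtain a b where ab: "a \<in> e" "a \<in> A" "b \<in> e" "b \<notin> A" using e by blast
    have "a \<in> fv f" "b \<in> fv f" using bd_fv[OF f(2)] ab by auto
    then have "f \<in> S" using ab(2) f unfolding A_def by blast
    then have "b \<in> A" using same[of b f] \<open>b \<in> fv f\<close> f ab e unfolding A_def by blast
    then show False using ab by blast
  qed
  then show ?thesis
  proof
    assume A: "A = {}"
    have "fv f \<subseteq> X" if "f \<in> S" for f
    proof (rule ccontr)
      assume "\<not> fv f \<subseteq> X"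
      moreover have f: "f \<in> F" using that S(1) by (rule subsetD[rotated])
      ultimately obtain y where y: "y \<in> fv f" "y \<in> Y" using fv_V[OF f] unfolding Y_def by blast
      then have "y \<in> A" using same[of y f] that f unfolding A_def by simp
      then show False using A by blast
    qed
    then show ?thesis using S bS by blast
  next
    assume A: "A = Y"
    have "fv f \<subseteq> X" if "f \<in> F - S" for f
    proof (rule ccontr)
      assume "\<not> fv f \<subseteq> X"
      moreover have f: "f \<in> F" using that by simp
      ultimately obtain y where y: "y \<in> fv f" "y \<in> Y" using fv_V[OF f] unfolding Y_def by blast
      then have "f \<in> S" using A f unfolding A_def by blast
      then show False using that by blast
    qed
    then have "F - S \<subseteq> {f \<in> F. fv f \<subseteq> X}" by blast
    then show ?thesis using bdry_compl[OF S(1)] bS by metis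
  qed
qed

text \<open>
  A dimension count over the two-element field. The sets of faces inside \<open>X\<close> whose boundary lies in an
  edge set \<open>H\<close> form a vector space \<open>SS H\<close>. If \<open>H\<close> has at least \<open>|X|\<close> edges, it contains a cycle, and
  this cycle is a boundary that is lost when one of its edges \<open>e\<close> is removed from \<open>H\<close>; so each
  such edge contributes one dimension. Dimensions are recorded as cardinalities, which are powers of
  two.
\<close>

lemma inner_faces_ge:
  assumes X: "X \<subseteq> V" "X \<noteq> {}" "card (cut X) \<le> 5"
  shows "card (inner X) + 1 \<le> card {f \<in> F. fv f \<subseteq> X} + card X"
proof -
  define I where "I = {f \<in> F. fv f \<subseteq> X}"
  define SS where "SS H = {S. S \<subseteq> I \<and> bdry S \<subseteq> H}" for H
  have IF: "I \<subseteq> F" unfolding I_def by blast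
  have fI: "finite I" using finite_F unfolding I_def by simp
  have fSS: "finite (SS H)" for H unfolding SS_def using fI by simp
  have fX: "finite X" using X finite_V finite_subset by blast
  have *: "2 ^ (card H + 1) \<le> card (SS H) * 2 ^ card X" if "H \<subseteq> inner X" for H
    using that
  proof (induction "card H" arbitrary: H rule: less_induct)
    case less
    have fH: "finite H" using less.prems finite_inner finite_subset by blast
    show ?case
    proof (cases "card H < card X")
      case True
      have "{} \<in> SS H" unfolding SS_def bdry_def by simp
      then have "1 \<le> card (SS H)" using fSS[of H] by (metis One_nat_def Suc_leI card_gt_0_iff emptyE)
      moreover have "(2::nat) ^ (card H + 1) \<le> 2 ^ card X" using True by (intro power_increasing) auto
      ultimately show ?thesis using mult_le_mono[of 1 "card (SS H)" "2 ^ (card H + 1)" "2 ^ card X"] by simp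
    next
      case False
      have HE: "H \<subseteq> E" using less.prems by (auto simp: induced_edges_def)
      have "\<exists>vs. cycle_in H vs"
        by (rule cycle_in_dense[OF fX X(2)]) (use less.prems False edge_card in \<open>auto simp: induced_edges_def\<close>)
      then obtain vs where vs: "cycle_in H vs" by blast
      then have c: "cycle_in E vs" "cycle_edges vs \<subseteq> inner X" "cycle_edges vs \<subseteq> H"
        using HE less.prems unfolding cycle_in_def by auto
      obtain S0 where S0: "S0 \<subseteq> I" "bdry S0 = cycle_edges vs"
        using cycle_bounds_inner_faces[OF X(1,3) c(1,2)] unfolding I_def by blast
      have "vs \<noteq> []" using vs by (auto simp: cycle_in_def)
      then obtain e where e: "e \<in> cycle_edges vs" using cycle_edges_walk by blast
      have eH: "e \<in> H" using e c by blast
      have xor: "d \<in> bdry (sym_diff S0 T) \<longleftrightarrow> (d \<in> bdry S0) \<noteq> (d \<in> bdry T)" if d: "T \<subseteq> I" "d \<in> E" for T d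
      proof -
        obtain f g where "f \<in> F" "g \<in> F" "f \<noteq> g" and fg: "{h \<in> F. d \<in> bd h} = {f, g}"
          by (rule edge_face_pair[OF d(2)])
        have "sym_diff S0 T \<subseteq> F" "S0 \<subseteq> F" "T \<subseteq> F" using S0 d IF by auto
        then have "d \<in> bdry (sym_diff S0 T) \<longleftrightarrow> (f \<in> sym_diff S0 T) \<noteq> (g \<in> sym_diff S0 T)"
          "d \<in> bdry S0 \<longleftrightarrow> (f \<in> S0) \<noteq> (g \<in> S0)" "d \<in> bdry T \<longleftrightarrow> (f \<in> T) \<noteq> (g \<in> T)"
          using bdry_pair[OF d(2) fg] by presburger+
        then show ?thesis by blast
      qed
      have c1: "card (H - {e}) = card H - 1" using eH fH by simp
      have cH: "card H > 0" using eH fH by (auto simp: card_gt_0_iff)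
      have IH: "2 ^ (card (H - {e}) + 1) \<le> card (SS (H - {e})) * 2 ^ card X"
        by (rule less.hyps) (use less.prems c1 cH in auto)
      \<comment> \<open>Adding \<open>S0\<close> modulo 2 maps the sets whose boundary avoids \<open>e\<close> injectively to sets whose boundary contains it.\<close>
      let ?A = "SS (H - {e})"
      let ?B = "(\<lambda>T. sym_diff S0 T) ` ?A"
      have "?A \<subseteq> SS H" unfolding SS_def by blast
      moreover have "?B \<subseteq> SS H"
      proof
        fix S assume "S \<in> ?B"
        then obtain T where T: "T \<subseteq> I" "bdry T \<subseteq> H - {e}" "S = sym_diff S0 T" unfolding SS_def by blast
        have "bdry S \<subseteq> H"
        proof
          fix d assume d: "d \<in> bdry S"
          then have "d \<in> E" unfolding bdry_def by blast
          then have "d \<in> bdry S0 \<or> d \<in> bdry T" using xor[OF T(1)] d T(3) by blast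
          then show "d \<in> H" using S0 c T by blast
        qed
        moreover have "S \<subseteq> I" using T S0 by blast
        ultimately show "S \<in> SS H" unfolding SS_def by blast
      qed
      moreover have "?A \<inter> ?B = {}"
      proof (rule equals0I)
        fix S assume "S \<in> ?A \<inter> ?B"
        then obtain T where T: "T \<subseteq> I" "bdry T \<subseteq> H - {e}" "S = sym_diff S0 T" "bdry S \<subseteq> H - {e}" unfolding SS_def by blast
        then have "e \<in> bdry S" using xor[OF T(1), of e] e S0 HE eH by blast
        then show False using T by blast
      qed
      moreover have "card ?B = card ?A"
      proof (rule card_image)
        show "inj_on (\<lambda>T. sym_diff S0 T) ?A" by (auto simp: inj_on_def)
      qed
      ultimately have "2 * card ?A \<le> card (SS H)"
        using card_Un_disjoint[OF fSS finite_imageI[OF fSS], of "H - {e}" "\<lambda>T. sym_diff S0 T" "H - {e}"]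
          card_mono[OF fSS, of "?A \<union> ?B" H] by simp
      then have "2 * card ?A * 2 ^ card X \<le> card (SS H) * 2 ^ card X" by (rule mult_le_mono1)
      moreover have "(2::nat) ^ (card H + 1) = 2 * 2 ^ (card (H - {e}) + 1)" using c1 cH by (simp add: power_eq_if)
      ultimately show ?thesis using IH by linarith
    qed
  qed
  have "SS (inner X) \<subseteq> Pow I" unfolding SS_def by blast
  then have "card (SS (inner X)) \<le> 2 ^ card I" using fI by (metis card_Pow card_mono finite_Pow_iff)
  then have "card (SS (inner X)) * 2 ^ card X \<le> 2 ^ card I * 2 ^ card X" by (rule mult_le_mono1)
  then have "(2::nat) ^ (card (inner X) + 1) \<le> 2 ^ (card I + card X)"
    using *[OF order_refl] by (metis order_trans power_add)
  then have "card (inner X) + 1 \<le> card I + card X" by (rule power_le_imp_le_exp[rotated]) simp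
  then show ?thesis unfolding I_def .
qed

subsection \<open>Girth\<close>

lemma dense_contains_face:
  assumes "X \<subseteq> V" "X \<noteq> {}" "card (cut X) \<le> 5" "card X \<le> card (inner X)"
  shows "\<exists>f\<in>F. fv f \<subseteq> X"
proof -
  have "card {f \<in> F. fv f \<subseteq> X} > 0" using inner_faces_ge[OF assms(1-3)] assms(4) by linarith
  then show ?thesis by (auto simp: card_gt_0_iff)
qed

text \<open>
  A set of at most five vertices with this many inner edges has a small cut, so it contains a
  face, and a face has at least five vertices.
\<close>

lemma dense_card_ge_5:
  assumes "X \<subseteq> V" "X \<noteq> {}" "card X \<le> 5" "card X \<le> card (inner X)"
  shows "card X = 5" "\<exists>f\<in>F. fv f = X"
proof -
  have "card (cut X) \<le> 5" using degree_sum[OF assms(1)] assms by linarith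
  then obtain f where f: "f \<in> F" "fv f \<subseteq> X" using dense_contains_face assms by blast
  have fX: "finite X" using assms finite_V finite_subset by blast
  have "card (fv f) \<le> card X" by (rule card_mono[OF fX f(2)])
  then have c: "card X = 5" "card (fv f) = 5" using card_fv[OF f(1)] assms(3) by linarith+
  then show "card X = 5" by simp
  show "\<exists>f\<in>F. fv f = X" using card_subset_eq[OF fX f(2)] c f by auto
qed

lemma no_triangle:
  assumes "{a, b} \<in> E" "{b, c} \<in> E" "{a, c} \<in> E" shows False
proof -
  have d: "a \<noteq> b" "b \<noteq> c" "a \<noteq> c" using edge_neq assms by blast+
  have V: "{a, b, c} \<subseteq> V" using edge_in_V assms by blast
  have "{{a, b}, {b, c}, {a, c}} \<subseteq> inner {a, b, c}" using assms by (auto simp: induced_edges_def)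
  then have "card {{a, b}, {b, c}, {a, c}} \<le> card (inner {a, b, c})" by (rule card_mono[OF finite_inner])
  moreover have "card {{a, b}, {b, c}, {a, c}} = 3" using d by (simp add: card_insert_if doubleton_eq_iff)
  moreover have "card {a, b, c} = 3" using d by simp
  ultimately show False using dense_card_ge_5(1)[OF V] by simp
qed

lemma no_4_cycle:
  assumes "{a, b} \<in> E" "{b, c} \<in> E" "{c, d} \<in> E" "{d, a} \<in> E" "a \<noteq> c" "b \<noteq> d" shows False
proof -
  have d: "a \<noteq> b" "b \<noteq> c" "c \<noteq> d" "d \<noteq> a" using edge_neq assms by blast+
  have V: "{a, b, c, d} \<subseteq> V" using edge_in_V assms by blast
  have "{{a, b}, {b, c}, {c, d}, {d, a}} \<subseteq> inner {a, b, c, d}" using assms by (auto simp: induced_edges_def)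
  then have "card {{a, b}, {b, c}, {c, d}, {d, a}} \<le> card (inner {a, b, c, d})" by (rule card_mono[OF finite_inner])
  moreover have "card {{a, b}, {b, c}, {c, d}, {d, a}} = 4" using d assms(5,6) by (simp add: card_insert_if doubleton_eq_iff)
  moreover have "card {a, b, c, d} = 4" using d assms(5,6) by simp
  ultimately show False using dense_card_ge_5(1)[OF V] by simp
qed

lemma five_cycle_face:
  assumes "distinct [a, b, c, d, e]"
    "{a, b} \<in> E" "{b, c} \<in> E" "{c, d} \<in> E" "{d, e} \<in> E" "{e, a} \<in> E"
  shows "\<exists>f\<in>F. fv f = {a, b, c, d, e}"
proof -
  let ?H = "{{a, b}, {b, c}, {c, d}, {d, e}, {e, a}}"
  have V: "{a, b, c, d, e} \<subseteq> V" using edge_in_V assms by blast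
  have "?H \<subseteq> inner {a, b, c, d, e}" using assms by (auto simp: induced_edges_def)
  then have "card ?H \<le> card (inner {a, b, c, d, e})" by (rule card_mono[OF finite_inner])
  moreover have "card ?H = 5" using assms(1) by (auto simp: card_insert_if doubleton_eq_iff)
  moreover have "card {a, b, c, d, e} = 5" using assms(1) by simp
  ultimately show ?thesis using dense_card_ge_5(2)[OF V] by simp
qed

subsection \<open>Shape of a face\<close>

lemma face_shape:
  assumes "f \<in> F" "v \<in> fv f"
  obtains (pentagon) p q r s where "distinct [v, p, q, r, s]" "fv f = {v, p, q, r, s}"
      "bd f = {{v, p}, {p, q}, {q, r}, {r, s}, {s, v}}"
    | (hexagon) p q r s t where "distinct [v, p, q, r, s, t]" "fv f = {v, p, q, r, s, t}"
      "bd f = {{v, p}, {p, q}, {q, r}, {r, s}, {s, t}, {t, v}}"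
proof -
  obtain vs where vs: "cycle_in E vs" "length vs = 5 \<or> length vs = 6" "bd f = cycle_edges vs" "fv f = set vs"
    using assms(1) by (rule face_list)
  have "v \<in> set vs" using vs assms by simp
  then obtain p zs where z: "cycle_in E (v # p # zs)" "zs \<noteq> []" "length (v # p # zs) = length vs"
    "cycle_edges (v # p # zs) = cycle_edges vs" "set (v # p # zs) = set vs"
    by (rule cycle_in_from[OF vs(1)])
  have d: "distinct (v # p # zs)" using z by (simp add: cycle_in_def)
  have b: "bd f = insert {last zs, v} (walk_edges (v # p # zs))"
    using cycle_edges_walk[of "v # p # zs"] z vs by simp
  have fvz: "fv f = set (v # p # zs)" using vs z by simp
  from vs(2) show ?thesis
  proof
    assume "length vs = 5"
    then have "length zs = Suc (Suc (Suc 0))" using z by simp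
    then obtain q r s where "zs = [q, r, s]" by (auto simp: length_Suc_conv)
    then show ?thesis using d b fvz by (intro pentagon[of p q r s]) (auto simp: insert_commute)
  next
    assume "length vs = 6"
    then have "length zs = Suc (Suc (Suc (Suc 0)))" using z by simp
    then obtain q r s t where "zs = [q, r, s, t]" by (auto simp: length_Suc_conv)
    then show ?thesis using d b fvz by (intro hexagon[of p q r s t]) (auto simp: insert_commute)
  qed
qed

lemma face_induced:
  assumes f: "f \<in> F" "v \<in> fv f" "w \<in> fv f" "{v, w} \<in> E"
  shows "{v, w} \<in> bd f"
  using f(1,2)
proof (cases rule: face_shape)
  case (pentagon p q r s)
  have E: "{v, p} \<in> E" "{p, q} \<in> E" "{q, r} \<in> E" "{r, s} \<in> E" "{s, v} \<in> E"
    using bd_E[OF f(1)] unfolding pentagon(3) by blast+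
  have "w \<noteq> v" using edge_neq f(4) by blast
  moreover have "w \<noteq> q" using no_triangle[of v p q] E f(4) by blast
  moreover have "w \<noteq> r" using no_triangle[of v s r] E f(4) by (auto simp: insert_commute)
  ultimately show ?thesis using f(3) unfolding pentagon(2,3) by (auto simp: insert_commute)
next
  case (hexagon p q r s t)
  have E: "{v, p} \<in> E" "{p, q} \<in> E" "{q, r} \<in> E" "{r, s} \<in> E" "{s, t} \<in> E" "{t, v} \<in> E"
    using bd_E[OF f(1)] unfolding hexagon(3) by blast+
  have "w \<noteq> v" using edge_neq f(4) by blast
  moreover have "w \<noteq> q" using no_triangle[of v p q] E f(4) by blast
  moreover have "w \<noteq> s" using no_triangle[of v t s] E f(4) by (auto simp: insert_commute)
  moreover have "w \<noteq> r" using no_4_cycle[of v p q r] E f(4) hexagon(1) by (auto simp: insert_commute)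
  ultimately show ?thesis using f(3) unfolding hexagon(2,3) by (auto simp: insert_commute)
qed

lemma inner_fv: "f \<in> F \<Longrightarrow> inner (fv f) = bd f"
proof
  assume f: "f \<in> F"
  show "bd f \<subseteq> inner (fv f)" using bd_fv bd_E[OF f] by (auto simp: induced_edges_def)
  show "inner (fv f) \<subseteq> bd f"
  proof
    fix e assume "e \<in> inner (fv f)"
    then have e: "e \<in> E" "e \<subseteq> fv f" by (auto simp: induced_edges_def)
    then obtain a b where "e = {a, b}" using edge_card by (meson card_2_iff)
    then show "e \<in> bd f" using face_induced[OF f, of a b] e by simp
  qed
qed

text \<open>
  Either the side induces a forest, where a degree count bounds the cut from below, or it contains a
  face, which leaves room for nothing else.
\<close>

lemma small_side:
  assumes "X \<subseteq> V" "X \<noteq> {}" "card X \<le> 5"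
  shows "card X + 2 \<le> card (cut X) \<or> (\<exists>f\<in>F. fv f = X \<and> card X = 5 \<and> card (cut X) = 5)"
proof (cases "card X \<le> card (inner X)")
  case False then show ?thesis using degree_sum[OF assms(1)] by linarith
next
  case True
  obtain f where f: "f \<in> F" "fv f = X" using dense_card_ge_5[OF assms True] by blast
  have X: "card X = 5" by (rule dense_card_ge_5[OF assms True])
  then have "card (inner X) = 5" using inner_fv[OF f(1)] card_bd[OF f(1)] f by simp
  then have "card (cut X) = 5" using degree_sum[OF assms(1)] X by linarith
  then show ?thesis using f X by blast
qed

lemma face_not_split:
  assumes "f \<in> F" "bd f \<inter> cut X = {}" "fv f \<inter> X \<noteq> {}" shows "fv f \<subseteq> X"
proof (rule ccontr)
  assume no: "\<not> fv f \<subseteq> X"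
  obtain vs where vs: "cycle_in E vs" "length vs = 5 \<or> length vs = 6" "bd f = cycle_edges vs" "fv f = set vs"
    using assms(1) by (rule face_list)
  have "vs \<noteq> []" using vs(2) by auto
  obtain e where e: "e \<in> walk_edges vs" "e \<inter> X \<noteq> {}" "\<not> e \<subseteq> X"
    using walk_crosses[of vs X] no assms(3) vs(4) by auto
  then have "e \<in> bd f" using cycle_edges_walk[OF \<open>vs \<noteq> []\<close>] vs(3) by blast
  moreover then have "e \<in> cut X" using bd_E[OF assms(1)] e by (auto simp: cut_def)
  ultimately show False using assms(2) by blast
qed

subsection \<open>Peeling a side of a small cut\<close>

definition crossing :: "'a set \<Rightarrow> 'f set" where "crossing X = {f \<in> F. bd f \<inter> cut X \<noteq> {}}"

definition cut_ends :: "'a set \<Rightarrow> 'a set" where "cut_ends X = {x \<in> X. \<exists>e\<in>cut X. x \<in> e}"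

text \<open>
  Counts, with multiplicity, the vertices of \<open>X\<close> that lie on a face meeting the cut but are not ends
  of cut edges. These are the
  vertices next to the cut from which an edge can lead deeper into \<open>X\<close>.
\<close>

definition excess :: "'a set \<Rightarrow> nat" where
  "excess X = (\<Sum>f\<in>crossing X. card (fv f \<inter> X - cut_ends X))"

definition core :: "'a set \<Rightarrow> 'a set" where "core X = {x \<in> X. \<forall>f\<in>crossing X. x \<notin> fv f}"

text \<open>
  No vertex of \<open>X\<close> lies on two cut edges. Otherwise moving the vertex to the other side gives a smaller
  cut, see \<open>cut_remove_vertex\<close>.
\<close>

definition matching_cut :: "'a set \<Rightarrow> bool" where
  "matching_cut X \<longleftrightarrow> (\<forall>x\<in>X. card {e \<in> cut X. x \<in> e} \<le> 1)"

lemma finite_crossing [simp]: "finite (crossing X)"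
  using finite_F by (simp add: crossing_def)

lemma sum_face_cut: "(\<Sum>f\<in>crossing X. card (bd f \<inter> cut X)) = 2 * card (cut X)"
proof -
  have "(\<Sum>f\<in>crossing X. card (bd f \<inter> cut X)) = (\<Sum>f\<in>F. card (bd f \<inter> cut X))"
    by (rule sum.mono_neutral_left) (auto simp: crossing_def finite_F)
  also have "\<dots> = (\<Sum>f\<in>F. card {e \<in> cut X. e \<in> bd f})" by (simp add: Int_def conj_commute)
  also have "\<dots> = (\<Sum>e\<in>cut X. card {f \<in> F. e \<in> bd f})" by (rule double_count) (simp_all add: finite_F)
  also have "\<dots> = (\<Sum>e\<in>cut X. 2)" by (rule sum.cong) (use two_faces in \<open>auto simp: cut_def\<close>)
  finally show ?thesis by simp
qed

lemma crossing_twice: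
  assumes "X \<subseteq> V" "f \<in> crossing X" shows "2 \<le> card (bd f \<inter> cut X)"
proof -
  have f: "f \<in> F" "bd f \<inter> cut X \<noteq> {}" using assms by (auto simp: crossing_def)
  then have "card (bd f \<inter> cut X) > 0" by (simp add: card_gt_0_iff)
  moreover have "even (card (bd f \<inter> cut X))" using face_count[OF f(1) assms(1)] by presburger
  ultimately show ?thesis by presburger
qed

lemma card_crossing: assumes "X \<subseteq> V" shows "card (crossing X) \<le> card (cut X)"
proof -
  have "(\<Sum>f\<in>crossing X. 2) \<le> (\<Sum>f\<in>crossing X. card (bd f \<inter> cut X))"
    by (rule sum_mono) (use crossing_twice[OF assms] in auto)
  then show ?thesis using sum_face_cut by simp
qed

lemma face_cut_ends:
  assumes "X \<subseteq> V" "f \<in> F" "matching_cut X"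
  shows "card (bd f \<inter> cut X) \<le> card (fv f \<inter> cut_ends X)"
proof -
  let ?T = "fv f \<inter> cut_ends X"
  have fT: "finite ?T" using finite_fv assms by simp
  have "bd f \<inter> cut X \<subseteq> (\<Union>x\<in>?T. {e \<in> bd f \<inter> cut X. x \<in> e})"
  proof
    fix e assume e: "e \<in> bd f \<inter> cut X"
    then obtain x where "x \<in> e" "x \<in> X" by (auto simp: cut_def)
    then have "x \<in> ?T" using e by (auto simp: cut_ends_def fv_def)
    then show "e \<in> (\<Union>x\<in>?T. {e \<in> bd f \<inter> cut X. x \<in> e})" using e \<open>x \<in> e\<close> by blast
  qed
  then have "card (bd f \<inter> cut X) \<le> card (\<Union>x\<in>?T. {e \<in> bd f \<inter> cut X. x \<in> e})"
    by (rule card_mono[rotated]) (use fT in simp)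
  also have "\<dots> \<le> (\<Sum>x\<in>?T. card {e \<in> bd f \<inter> cut X. x \<in> e})" by (rule card_UN_le[OF fT])
  also have "\<dots> \<le> (\<Sum>x\<in>?T. 1)"
  proof (rule sum_mono)
    fix x assume "x \<in> ?T"
    then have "card {e \<in> cut X. x \<in> e} \<le> 1" using assms by (auto simp: matching_cut_def cut_ends_def)
    moreover have "card {e \<in> bd f \<inter> cut X. x \<in> e} \<le> card {e \<in> cut X. x \<in> e}" by (rule card_mono) auto
    ultimately show "card {e \<in> bd f \<inter> cut X. x \<in> e} \<le> 1" by linarith
  qed
  finally show ?thesis by simp
qed

lemma face_split_ends:
  assumes "f \<in> F"
  shows "card (fv f \<inter> X) = card (fv f \<inter> X - cut_ends X) + card (fv f \<inter> cut_ends X)"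
proof -
  have "fv f \<inter> X = (fv f \<inter> X - cut_ends X) \<union> (fv f \<inter> cut_ends X)" by (auto simp: cut_ends_def)
  then show ?thesis using finite_fv[OF assms] by (metis Diff_disjoint Int_Diff card_Un_disjoint finite_Diff finite_Int inf.commute inf_left_commute Int_assoc)
qed

text \<open>
  A face meeting the cut has at most six vertices. At least two of them on each side are ends of cut
  edges, so at most two contribute to an excess, and there are no more such faces than cut edges.
\<close>

lemma excess_both_sides:
  assumes X: "X \<subseteq> V" and m: "matching_cut X" "matching_cut (V - X)"
  shows "excess X + excess (V - X) \<le> 2 * card (cut X)"
proof -
  let ?Y = "V - X"
  have cY: "cut ?Y = cut X" by (rule cut_compl[OF X])
  have crY: "crossing ?Y = crossing X" by (simp add: crossing_def cY)
  have "excess X + excess ?Y = (\<Sum>f\<in>crossing X. card (fv f \<inter> X - cut_ends X) + card (fv f \<inter> ?Y - cut_ends ?Y))"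
    by (simp add: excess_def crY sum.distrib)
  also have "\<dots> \<le> (\<Sum>f\<in>crossing X. 2)"
  proof (rule sum_mono)
    fix f assume c: "f \<in> crossing X"
    then have f: "f \<in> F" by (simp add: crossing_def)
    have "2 \<le> card (fv f \<inter> cut_ends X)" using face_cut_ends[OF X f m(1)] crossing_twice[OF X c] by linarith
    moreover have "2 \<le> card (fv f \<inter> cut_ends ?Y)"
      using face_cut_ends[OF _ f m(2)] crossing_twice[OF X c] cY by fastforce
    moreover have "card (fv f) = card (fv f \<inter> X) + card (fv f \<inter> ?Y)"
    proof -
      have "fv f = (fv f \<inter> X) \<union> (fv f \<inter> ?Y)" using fv_V[OF f] by blast
      moreover have "(fv f \<inter> X) \<inter> (fv f \<inter> ?Y) = {}" by blast
      ultimately show ?thesis using finite_fv[OF f] by (metis card_Un_disjoint finite_Int)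
    qed
    ultimately show "card (fv f \<inter> X - cut_ends X) + card (fv f \<inter> ?Y - cut_ends ?Y) \<le> 2"
      using face_split_ends[OF f, of X] face_split_ends[OF f, of ?Y] card_fv[OF f] by linarith
  qed
  also have "\<dots> \<le> 2 * card (cut X)" using card_crossing[OF X] by simp
  finally show ?thesis .
qed

text \<open>
  Count the incidences of inner edges with faces: an inner edge has two, a face inside \<open>X\<close> contributes
  its length, and the faces that meet the cut contribute at least the excess plus one for
  each cut edge.
\<close>

lemma inner_edge_count:
  assumes X: "X \<subseteq> V" and m: "matching_cut X"
  shows "(\<Sum>f\<in>{f \<in> F. fv f \<subseteq> X}. card (fv f)) + excess X + card (cut X) \<le> 2 * card (inner X)"
proof -
  let ?I = "{f \<in> F. fv f \<subseteq> X}"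
  have "(\<Sum>f\<in>F. card (bd f \<inter> inner X)) = (\<Sum>f\<in>F. card {e \<in> inner X. e \<in> bd f})" by (simp add: Int_def conj_commute)
  also have "\<dots> = (\<Sum>e\<in>inner X. card {f \<in> F. e \<in> bd f})" by (rule double_count) (simp_all add: finite_F)
  also have "\<dots> = (\<Sum>e\<in>inner X. 2)" by (rule sum.cong) (use two_faces in \<open>auto simp: induced_edges_def\<close>)
  finally have tot: "(\<Sum>f\<in>F. card (bd f \<inter> inner X)) = 2 * card (inner X)" by simp
  have disj: "?I \<inter> crossing X = {}"
    using bd_fv unfolding crossing_def cut_def by blast
  have "(\<Sum>f\<in>?I. card (bd f \<inter> inner X)) + (\<Sum>f\<in>crossing X. card (bd f \<inter> inner X))
      = (\<Sum>f\<in>?I \<union> crossing X. card (bd f \<inter> inner X))"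
    using disj finite_F by (intro sum.union_disjoint[symmetric]) auto
  also have "\<dots> \<le> (\<Sum>f\<in>F. card (bd f \<inter> inner X))"
    using finite_F by (intro sum_mono2) (auto simp: crossing_def)
  finally have 1: "(\<Sum>f\<in>?I. card (bd f \<inter> inner X)) + (\<Sum>f\<in>crossing X. card (bd f \<inter> inner X)) \<le> 2 * card (inner X)"
    using tot by simp
  have 2: "(\<Sum>f\<in>?I. card (bd f \<inter> inner X)) = (\<Sum>f\<in>?I. card (fv f))"
  proof (rule sum.cong)
    fix f assume f: "f \<in> ?I"
    then have "bd f \<inter> inner X = bd f" using bd_fv bd_E by (fastforce simp: induced_edges_def)
    then show "card (bd f \<inter> inner X) = card (fv f)" using card_bd f by simp
  qed simp
  have "(\<Sum>f\<in>crossing X. 2 * card (fv f \<inter> X - cut_ends X) + card (bd f \<inter> cut X))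
      \<le> (\<Sum>f\<in>crossing X. 2 * card (bd f \<inter> inner X))"
  proof (rule sum_mono)
    fix f assume "f \<in> crossing X"
    then have f: "f \<in> F" by (simp add: crossing_def)
    show "2 * card (fv f \<inter> X - cut_ends X) + card (bd f \<inter> cut X) \<le> 2 * card (bd f \<inter> inner X)"
      using face_count[OF f X] face_split_ends[OF f, of X] face_cut_ends[OF X f m] by linarith
  qed
  then have "2 * excess X + 2 * card (cut X) \<le> 2 * (\<Sum>f\<in>crossing X. card (bd f \<inter> inner X))"
    by (simp add: excess_def sum.distrib sum_face_cut sum_distrib_left)
  then show ?thesis using 1 2 by linarith
qed

text \<open>
  Combines \<open>inner_edge_count\<close> with \<open>inner_faces_ge\<close> and the fact that faces have length at least five. A
  hexagon inside \<open>X\<close> improves the bound.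
\<close>

lemma side_size:
  assumes X: "X \<subseteq> V" "X \<noteq> {}" "card (cut X) \<le> 5" and m: "matching_cut X"
  shows "10 + 2 * excess X \<le> card X + card (cut X)"
    and "\<lbrakk>f \<in> F; fv f \<subseteq> X; card (fv f) = 6\<rbrakk> \<Longrightarrow> 12 + 2 * excess X \<le> card X + card (cut X)"
proof -
  let ?I = "{f \<in> F. fv f \<subseteq> X}"
  have fI: "finite ?I" using finite_F by simp
  have five: "5 \<le> card (fv f)" if "f \<in> F" for f using card_fv[OF that] by linarith
  have "(\<Sum>f\<in>?I. 5) \<le> (\<Sum>f\<in>?I. card (fv f))" by (rule sum_mono) (use five in auto)
  then have "5 * card ?I \<le> (\<Sum>f\<in>?I. card (fv f))" by simp
  then show "10 + 2 * excess X \<le> card X + card (cut X)"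
    using inner_edge_count[OF X(1) m] inner_faces_ge[OF X] degree_sum[OF X(1)] by linarith
  assume f: "f \<in> F" "fv f \<subseteq> X" "card (fv f) = 6"
  have "(\<Sum>f\<in>?I. 5) < (\<Sum>f\<in>?I. card (fv f))"
    by (rule sum_strict_mono_ex1[OF fI]) (use five f in auto)
  then have "5 * card ?I + 1 \<le> (\<Sum>f\<in>?I. card (fv f))" by simp
  then show "12 + 2 * excess X \<le> card X + card (cut X)"
    using inner_edge_count[OF X(1) m] inner_faces_ge[OF X] degree_sum[OF X(1)] by linarith
qed

definition layer :: "'a set \<Rightarrow> 'a set" where
  "layer X = (\<Union>f\<in>crossing X. fv f \<inter> X - cut_ends X)"

lemma finite_layer: "X \<subseteq> V \<Longrightarrow> finite (layer X)"
  unfolding layer_def using finite_V finite_subset by (intro finite_UN_I) (auto intro: finite_subset)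

lemma card_layer: "card (layer X) \<le> excess X"
  unfolding layer_def excess_def by (rule card_UN_le) simp

lemma card_cut_ends: "card (cut_ends X) \<le> card (cut X)"
proof -
  have "cut_ends X = (\<Union>e\<in>cut X. e \<inter> X)" by (auto simp: cut_ends_def)
  then have "card (cut_ends X) \<le> (\<Sum>e\<in>cut X. card (e \<inter> X))" by (metis card_UN_le finite_cut)
  also have "\<dots> \<le> (\<Sum>e\<in>cut X. 1)"
  proof (rule sum_mono)
    fix e assume e: "e \<in> cut X"
    then have "card e = 2" using edge_card by (simp add: cut_def)
    moreover have "finite e" using \<open>card e = 2\<close> card.infinite by fastforce
    moreover have "e \<inter> X \<subset> e" using e by (auto simp: cut_def)
    ultimately have "card (e \<inter> X) < 2" by (metis psubset_card_mono)
    then show "card (e \<inter> X) \<le> 1" by simp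
  qed
  finally show ?thesis by simp
qed

lemma card_core:
  assumes "X \<subseteq> V" shows "card X \<le> card (core X) + card (cut X) + excess X"
proof -
  have "X \<subseteq> core X \<union> (cut_ends X \<union> layer X)" by (auto simp: core_def layer_def)
  moreover have "finite (core X)" "finite (cut_ends X)" "finite (layer X)"
    using assms finite_V finite_layer by (auto simp: core_def cut_ends_def intro: finite_subset)
  ultimately have "card X \<le> card (core X \<union> (cut_ends X \<union> layer X))" by (intro card_mono) auto
  also have "\<dots> \<le> card (core X) + (card (cut_ends X) + card (layer X))"
    by (meson add_left_mono card_Un_le order_trans)
  finally show ?thesis using card_layer[of X] card_cut_ends[of X] by linarith
qed

lemma edge_in_crossing:
  assumes "e \<in> cut X" obtains f where "f \<in> crossing X" "e \<in> bd f"
proof -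
  have "e \<in> E" using assms by (simp add: cut_def)
  then obtain f g where "f \<in> F" "g \<in> F" "f \<noteq> g" "{h \<in> F. e \<in> bd h} = {f, g}" by (rule edge_face_pair)
  then show ?thesis using that[of f] assms by (auto simp: crossing_def)
qed

text \<open>
  An end \<open>b\<close> outside the core lies on a face that meets the cut. It is no end of a cut edge \<open>d\<close>, since
  \<open>d\<close> and the edge to \<open>a\<close> would share a face, and \<open>a\<close> would be on a face that meets the cut.
\<close>

lemma cut_core_end:
  assumes X: "X \<subseteq> V" and e: "{a, b} \<in> E" "a \<in> core X" "b \<notin> core X"
  shows "b \<in> layer X"
proof -
  have aX: "a \<in> X" and ac: "\<And>f. f \<in> crossing X \<Longrightarrow> a \<notin> fv f" using e by (auto simp: core_def)
  have bX: "b \<in> X"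
  proof (rule ccontr)
    assume "b \<notin> X"
    then have "{a, b} \<in> cut X" using e aX by (auto simp: cut_def)
    then obtain f where f: "f \<in> crossing X" "{a, b} \<in> bd f" by (rule edge_in_crossing)
    then show False using ac[OF f(1)] bd_fv[OF f(2)] by blast
  qed
  then obtain f where f: "f \<in> crossing X" "b \<in> fv f" using e by (auto simp: core_def)
  have "b \<notin> cut_ends X"
  proof
    assume "b \<in> cut_ends X"
    then obtain d where d: "d \<in> cut X" "b \<in> d" by (auto simp: cut_ends_def)
    then have "d \<in> E" by (simp add: cut_def)
    then obtain g where g: "g \<in> F" "{a, b} \<in> bd g" "d \<in> bd g"
      using edges_at_vertex_share_face[of b "{a, b}" d] bX X e(1) d by blast
    then have "g \<in> crossing X" using d by (auto simp: crossing_def)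
    then show False using ac bd_fv[OF g(2)] by blast
  qed
  then show ?thesis using f bX by (auto simp: layer_def)
qed

text \<open>
  A vertex of the layer has two of its three edges on a face that meets the cut, hence at most one edge
  to the core.
\<close>

lemma card_cut_core:
  assumes X: "X \<subseteq> V" shows "card (cut (core X)) \<le> excess X"
proof -
  let ?C = "cut (core X)"
  have fT: "finite (layer X)" by (rule finite_layer[OF X])
  have ends: "\<exists>a b. e = {a, b} \<and> a \<in> core X \<and> b \<in> layer X \<and> e \<in> E" if "e \<in> ?C" for e
  proof -
    have e: "e \<in> E" "e \<inter> core X \<noteq> {}" "\<not> e \<subseteq> core X" using that by (auto simp: cut_def)
    then obtain a where a: "a \<in> e" "a \<in> core X" by blast
    obtain b where b: "e = {a, b}" by (rule edge_at[OF e(1) a(1)])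
    then have "b \<in> layer X" using cut_core_end[OF X, of a b] e a by auto
    then show ?thesis using a b e by blast
  qed
  have "?C \<subseteq> (\<Union>b\<in>layer X. {e \<in> ?C. b \<in> e})"
  proof
    fix e assume "e \<in> ?C"
    then show "e \<in> (\<Union>b\<in>layer X. {e \<in> ?C. b \<in> e})" using ends[of e] by blast
  qed
  then have "card ?C \<le> card (\<Union>b\<in>layer X. {e \<in> ?C. b \<in> e})"
    by (rule card_mono[rotated]) (use fT in simp)
  also have "\<dots> \<le> (\<Sum>b\<in>layer X. card {e \<in> ?C. b \<in> e})" by (rule card_UN_le[OF fT])
  also have "\<dots> \<le> (\<Sum>b\<in>layer X. 1)"
  proof (rule sum_mono)
    fix b assume b: "b \<in> layer X"
    then obtain f where f: "f \<in> crossing X" "b \<in> fv f" "b \<in> X" by (auto simp: layer_def)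
    have fF: "f \<in> F" using f by (simp add: crossing_def)
    have bV: "b \<in> V" using f X by blast
    have dis: "{e \<in> bd f. b \<in> e} \<inter> {e \<in> ?C. b \<in> e} = {}"
    proof (rule equals0I)
      fix e assume "e \<in> {e \<in> bd f. b \<in> e} \<inter> {e \<in> ?C. b \<in> e}"
      then have "e \<subseteq> fv f" "e \<inter> core X \<noteq> {}" using bd_fv by (auto simp: cut_def)
      then show False using f(1) by (auto simp: core_def)
    qed
    have "{e \<in> bd f. b \<in> e} \<union> {e \<in> ?C. b \<in> e} \<subseteq> {e \<in> E. b \<in> e}"
      using bd_E[OF fF] by (auto simp: cut_def)
    then have "card ({e \<in> bd f. b \<in> e} \<union> {e \<in> ?C. b \<in> e}) \<le> 3"
      using card_mono[of "{e \<in> E. b \<in> e}"] finite_E card_incident[OF bV] by auto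
    moreover have "finite (bd f)" using bd_E[OF fF] finite_E finite_subset by blast
    ultimately show "card {e \<in> ?C. b \<in> e} \<le> 1"
      using dis face_degree[OF fF f(2)] by (simp add: card_Un_disjoint)
  qed
  finally show ?thesis using card_layer[of X] by simp
qed

end

locale ipr_map = polyhedral_map +
  assumes isolated: "\<lbrakk>f \<in> F; g \<in> F; f \<noteq> g; card (bd f) = 5; card (bd g) = 5\<rbrakk> \<Longrightarrow> bd f \<inter> bd g = {}"
begin

text \<open>
  By \<open>side_size\<close> the side has at least \<open>10 + 2t - k\<close> vertices, where \<open>k\<close> is the size of the cut and \<open>t\<close>
  the excess, and peeling removes at most \<open>k + t\<close> of them. A core with at most five vertices has a cut of
  at most \<open>t\<close> edges, so by \<open>small_side\<close> it is too small unless it is a pentagon and \<open>k = t = 5\<close>. In that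
  case all bounds are tight and all faces inside \<open>X\<close> are pentagons, among them the neighbours of the core.
\<close>

lemma core_large:
  assumes X: "X \<subseteq> V" "card (cut X) \<le> 5" "6 \<le> card X" and m: "matching_cut X"
    and t: "excess X \<le> card (cut X)"
  shows "6 \<le> card (core X)"
proof (rule ccontr)
  assume "\<not> ?thesis"
  then have c5: "card (core X) \<le> 5" by simp
  have Xne: "X \<noteq> {}" using X by auto
  have coreX: "core X \<subseteq> X" by (auto simp: core_def)
  then have coreV: "core X \<subseteq> V" using X by blast
  note S = side_size[OF X(1) Xne X(2) m]
  show False
  proof (cases "core X = {}")
    case True
    then show False using S(1) card_core[OF X(1)] X by simp
  next
    case False
    consider "card (core X) + 2 \<le> card (cut (core X))"
      | g where "g \<in> F" "fv g = core X" "card (core X) = 5" "card (cut (core X)) = 5"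
      using small_side[OF coreV False c5] by blast
    then show False
    proof cases
      case 1
      then show False using S(1) card_core[OF X(1)] card_cut_core[OF X(1)] X t by linarith
    next
      case (2 g)
      \<comment> \<open>The lower bound on the side is 15 as well, and a hexagon inside it would raise that bound to 17.\<close>
      have tight: "card X \<le> 15" "excess X = 5" "card (cut X) = 5"
        using 2(3,4) card_core[OF X(1)] card_cut_core[OF X(1)] X(2) t by linarith+
      have g5: "card (bd g) = 5" using card_bd[OF 2(1)] 2 by simp
      then have "bd g \<noteq> {}" by auto
      then obtain e where e: "e \<in> bd g" by blast
      then have eE: "e \<in> E" using bd_E 2(1) by blast
      obtain h where h: "h \<in> F" "h \<noteq> g" "e \<in> bd h"
      proof -
        obtain f1 f2 where "f1 \<in> F" "f2 \<in> F" "f1 \<noteq> f2" "{h \<in> F. e \<in> bd h} = {f1, f2}"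
          using eE by (rule edge_face_pair)
        then show ?thesis using that[of f1] that[of f2] by blast
      qed
      have "e \<noteq> {}" using edge_card[OF eE] by auto
      then obtain v where v: "v \<in> fv h" "v \<in> core X" using bd_fv[OF h(3)] bd_fv[OF e] 2(2) by blast
      then have "h \<notin> crossing X" by (auto simp: core_def)
      then have "fv h \<subseteq> X" using face_not_split[OF h(1), of X] v coreX h(1) by (auto simp: crossing_def)
      then have "card (fv h) \<noteq> 6" using S(2)[OF h(1)] tight by linarith
      then have "card (bd h) = 5" using card_fv[OF h(1)] card_bd[OF h(1)] by simp
      then show False using isolated[OF h(1) 2(1) h(2) _ g5] h e by blast
    qed
  qed
qed

lemma cut_remove_vertex:
  assumes X: "X \<subseteq> V" "x \<in> X" and c: "2 \<le> card {e \<in> cut X. x \<in> e}"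
  shows "card (cut (X - {x})) < card (cut X)"
proof -
  let ?A = "{e \<in> cut X. x \<in> e}"
  let ?B = "{e \<in> E. x \<in> e}"
  have sub: "?A \<subseteq> ?B" by (auto simp: cut_def)
  have fB: "finite ?B" using finite_E by simp
  have cB: "card ?B = 3" using card_incident X by blast
  have "cut (X - {x}) \<subseteq> (cut X - ?A) \<union> (?B - ?A)"
  proof
    fix e assume e: "e \<in> cut (X - {x})"
    then have eE: "e \<in> E" by (simp add: cut_def)
    show "e \<in> (cut X - ?A) \<union> (?B - ?A)"
    proof (cases "x \<in> e")
      case False then show ?thesis using e by (auto simp: cut_def)
    next
      case True
      then obtain w where w: "e = {x, w}" using edge_at[OF eE] by blast
      then have "w \<in> X" using e by (auto simp: cut_def)
      then show ?thesis using w X eE by (auto simp: cut_def)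
    qed
  qed
  then have "card (cut (X - {x})) \<le> card ((cut X - ?A) \<union> (?B - ?A))" using fB by (intro card_mono) auto
  also have "\<dots> \<le> card (cut X - ?A) + card (?B - ?A)" by (rule card_Un_le)
  also have "card (cut X - ?A) = card (cut X) - card ?A" by (rule card_Diff_subset) auto
  also have "card (?B - ?A) = 3 - card ?A" using sub cB fB by (subst card_Diff_subset) (auto intro: finite_subset)
  finally have "card (cut (X - {x})) \<le> card (cut X) - card ?A + (3 - card ?A)" .
  moreover have "card ?A \<le> card (cut X)" by (rule card_mono) auto
  ultimately show ?thesis using c by linarith
qed

text \<open>
  In a counterexample with as few cut edges as possible and then with \<open>X\<close> as small as possible, the cut
  is a matching. The two excesses sum to at most \<open>2 * k\<close>, where \<open>k\<close> is the size of the cut. If the excess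
  of \<open>X\<close> is at most \<open>k\<close>, its core gives a counterexample with no more cut edges and a smaller side.
  Otherwise the excess of the complement is less than \<open>k\<close>, and the core of the complement gives a
  counterexample with fewer cut edges.
\<close>

theorem small_cut_small_side:
  assumes "X \<subseteq> V" "card (cut X) \<le> 5"
  shows "card X \<le> 5 \<or> card (V - X) \<le> 5"
proof -
  have "\<forall>X. X \<subseteq> V \<longrightarrow> card (cut X) = k \<longrightarrow> card X \<le> 5 \<or> card (V - X) \<le> 5" if "k \<le> 5" for k
    using that
  proof (induction k rule: less_induct)
    case (less k)
    have IH: "card Z \<le> 5 \<or> card (V - Z) \<le> 5" if "Z \<subseteq> V" "card (cut Z) < k" for Z
      using less that by auto
    have matching: "matching_cut Z"
      if Z: "Z \<subseteq> V" "card (cut Z) = k" "6 \<le> card Z" "6 \<le> card (V - Z)" for Z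
    proof (rule ccontr)
      assume "\<not> matching_cut Z"
      then obtain x where x: "x \<in> Z" "2 \<le> card {e \<in> cut Z. x \<in> e}" by (force simp: matching_cut_def)
      have lt: "card (cut (Z - {x})) < k" using cut_remove_vertex[OF Z(1) x] Z(2) by simp
      have sub: "Z - {x} \<subseteq> V" using Z by blast
      have "card (V - Z) \<le> card (V - (Z - {x}))" using finite_V by (intro card_mono) auto
      then have le: "card (Z - {x}) \<le> 5" using IH[OF sub lt] Z by linarith
      moreover have "card (Z - {x}) = card Z - 1" using x by simp
      ultimately have "card (Z - {x}) = 5" using Z by linarith
      moreover then have "Z - {x} \<noteq> {}" by (metis card.empty zero_neq_numeral)
      ultimately show False using small_side[OF sub _ le] lt less.prems by auto
    qed
    have "False" if "X \<subseteq> V" "card (cut X) = k" "6 \<le> card X" "6 \<le> card (V - X)" for X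
      using that
    proof (induction "card X" arbitrary: X rule: less_induct)
      case (less X)
      let ?Y = "V - X"
      have k5: "k \<le> 5" by fact
      have Y: "?Y \<subseteq> V" "card (cut ?Y) = k" "V - ?Y = X" using less.prems cut_compl by auto
      have mX: "matching_cut X" using matching less.prems by blast
      have mY: "matching_cut ?Y" using matching[OF Y(1,2)] less.prems Y(3) by simp
      have both: "excess X + excess ?Y \<le> 2 * k" using excess_both_sides[OF less.prems(1) mX mY] less.prems by simp
      have coreX: "core X \<subseteq> X" and coreY: "core ?Y \<subseteq> ?Y" by (auto simp: core_def)
      show False
      proof (cases "excess X \<le> k")
        case True
        have cl: "6 \<le> card (core X)" using core_large[OF less.prems(1) _ less.prems(3) mX] True k5 less.prems by simp
        have cc: "card (cut (core X)) \<le> k" using card_cut_core[OF less.prems(1)] True by linarith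
        have "card ?Y \<le> card (V - core X)" using finite_V coreX by (intro card_mono) auto
        then have cr: "6 \<le> card (V - core X)" using less.prems by linarith
        have coreV: "core X \<subseteq> V" using coreX less.prems by blast
        have "X \<noteq> {}" "X \<noteq> V" using less.prems by auto
        then have "3 \<le> card (cut X)" using cut_ge_3 less.prems by blast
        then have "cut X \<noteq> {}" by auto
        then obtain e where e: "e \<in> cut X" by blast
        then obtain x where x: "x \<in> e" "x \<in> X" by (auto simp: cut_def)
        obtain f where "f \<in> crossing X" "e \<in> bd f" using e by (rule edge_in_crossing)
        then have "x \<notin> core X" using x bd_fv by (auto simp: core_def)
        then have "core X \<subset> X" using coreX x by blast
        then have "card (core X) < card X" using less.prems finite_V by (meson psubset_card_mono finite_subset)
        then show False
          using less.hyps[OF _ coreV _ cl cr] IH[OF coreV] cc cl cr by (cases "card (cut (core X)) = k") auto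
      next
        case False
        then have tY: "excess ?Y < k" using both by linarith
        have cl: "6 \<le> card (core ?Y)" using core_large[OF Y(1) _ less.prems(4) mY] tY k5 Y by simp
        have cc: "card (cut (core ?Y)) < k" using card_cut_core[OF Y(1)] tY by linarith
        have "card X \<le> card (V - core ?Y)" using finite_V coreY less.prems(1) by (intro card_mono) auto
        then have "6 \<le> card (V - core ?Y)" using less.prems by linarith
        moreover have "core ?Y \<subseteq> V" using coreY by blast
        ultimately show False using IH[of "core ?Y"] cc cl by linarith
      qed
    qed
    show ?case
    proof (intro allI impI, rule ccontr)
      fix X assume "X \<subseteq> V" "card (cut X) = k" "\<not> (card X \<le> 5 \<or> card (V - X) \<le> 5)"
      then show False using \<open>\<And>X. \<lbrakk>X \<subseteq> V; card (cut X) = k; 6 \<le> card X; 6 \<le> card (V - X)\<rbrakk> \<Longrightarrow> False\<close>[of X]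
        by linarith
    qed
  qed
  then show ?thesis using assms by blast
qed

subsection \<open>Neighbours outside a face\<close>

text \<open>
  Two face vertices with a common neighbour outside would lie on a triangle or a 4-cycle, except for
  opposite vertices of a hexagon: these give two 5-cycles sharing an edge, that is, two adjacent
  pentagonal faces.
\<close>

lemma no_outer_common_neighbour:
  assumes f: "f \<in> F" "v \<in> fv f" "w \<in> fv f" "v \<noteq> w"
    and x: "x \<notin> fv f" "{x, v} \<in> E" "{x, w} \<in> E"
  shows False
  using f(1,2)
proof (cases rule: face_shape)
  case (pentagon p q r s)
  have E: "{v, p} \<in> E" "{p, q} \<in> E" "{q, r} \<in> E" "{r, s} \<in> E" "{s, v} \<in> E"
    using bd_E[OF f(1)] unfolding pentagon(3) by blast+
  have E': "{p, v} \<in> E" "{v, s} \<in> E" "{s, r} \<in> E" "{w, x} \<in> E" "{v, x} \<in> E" using E x by (simp_all add: insert_commute)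
  have "w \<noteq> p" using no_triangle[of x v p] E x by blast
  moreover have "w \<noteq> s" using no_triangle[of x v s] E' x by blast
  moreover have "w \<noteq> q" using no_4_cycle[of x v p q] E E' x pentagon(1,2) by auto
  moreover have "w \<noteq> r" using no_4_cycle[of x v s r] E E' x pentagon(1,2) by auto
  ultimately show False using f(3,4) pentagon(2) by auto
next
  case (hexagon p q r s t)
  have E: "{v, p} \<in> E" "{p, q} \<in> E" "{q, r} \<in> E" "{r, s} \<in> E" "{s, t} \<in> E" "{t, v} \<in> E"
    using bd_E[OF f(1)] unfolding hexagon(3) by blast+
  have E': "{p, v} \<in> E" "{v, t} \<in> E" "{t, s} \<in> E" "{s, r} \<in> E" "{w, x} \<in> E" "{v, x} \<in> E" using E x by (simp_all add: insert_commute)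
  have "w \<noteq> p" using no_triangle[of x v p] E x by blast
  moreover have "w \<noteq> t" using no_triangle[of x v t] E' x by blast
  moreover have "w \<noteq> q" using no_4_cycle[of x v p q] E E' x hexagon(1,2) by auto
  moreover have "w \<noteq> s" using no_4_cycle[of x v t s] E E' x hexagon(1,2) by auto
  moreover have "w \<noteq> r"
  proof
    assume w: "w = r"
    have "distinct [x, v, p, q, r]" "distinct [x, v, t, s, r]" using hexagon(1,2) x(1) by auto
    then obtain g h where gh: "g \<in> F" "h \<in> F" "fv g = {x, v, p, q, r}" "fv h = {x, v, t, s, r}"
      using five_cycle_face[of x v p q r] five_cycle_face[of x v t s r] E E' x w by blast
    have "card (fv g) = 5" "card (fv h) = 5" using gh hexagon(1,2) x(1) by auto
    then have "card (bd g) = 5" "card (bd h) = 5" using card_bd gh by auto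
    moreover have "g \<noteq> h" using gh(3,4) hexagon(1,2) x(1) by auto
    moreover have "{x, v} \<in> bd g \<inter> bd h" using face_induced[of g x v] face_induced[of h x v] gh x by auto
    ultimately show False using isolated[OF gh(1,2)] by blast
  qed
  ultimately show False using f(3,4) hexagon(2) by auto
qed

end

section \<open>Partial automorphisms\<close>

lemma partial_aut_edge:
  assumes "partial_aut V E \<phi>" "\<phi> x = Some x'" "\<phi> y = Some y'"
  shows "{x, y} \<in> E \<longleftrightarrow> {x', y'} \<in> E"
proof -
  have d: "x \<in> dom \<phi>" "y \<in> dom \<phi>" "x' \<in> ran \<phi>" "y' \<in> ran \<phi>" using assms by (auto intro: ranI)
  then have "{x, y} \<in> induced_edges E (dom \<phi>) \<longleftrightarrow> {(the \<circ> \<phi>) x, (the \<circ> \<phi>) y} \<in> induced_edges E (ran \<phi>)"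
    using assms(1) unfolding partial_aut_def graph_iso_def by blast
  then show ?thesis using assms d by (simp add: induced_edges_def)
qed

lemma partial_aut_inj:
  assumes "partial_aut V E \<phi>" "\<phi> x = Some z" "\<phi> y = Some z" shows "x = y"
proof -
  have "inj_on (the \<circ> \<phi>) (dom \<phi>)" using assms(1) by (auto simp: partial_aut_def graph_iso_def bij_betw_def)
  moreover have "x \<in> dom \<phi>" "y \<in> dom \<phi>" "(the \<circ> \<phi>) x = (the \<circ> \<phi>) y" using assms by auto
  ultimately show ?thesis by (meson inj_onD)
qed

lemma supp_moved:
  assumes "partial_aut V E \<phi>" "\<phi> x = Some y" "x \<noteq> y" shows "x \<in> supp \<phi>" "y \<in> supp \<phi>"
proof -
  show "x \<in> supp \<phi>" using assms by (auto simp: supp_def)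
  have inj: "inj_on (the \<circ> \<phi>) (dom \<phi>)" using assms(1) by (auto simp: partial_aut_def graph_iso_def bij_betw_def)
  have "inv_into (dom \<phi>) (the \<circ> \<phi>) y = x"
    using inv_into_f_f[OF inj, of x] assms by auto
  then show "y \<in> supp \<phi>" using assms by (auto simp: supp_def intro: ranI)
qed

lemma supp_cases:
  assumes "partial_aut V E \<phi>" "v \<in> supp \<phi>"
  obtains w where "\<phi> v = Some w" "w \<noteq> v" | u where "\<phi> u = Some v" "u \<noteq> v"
proof -
  from assms(2) consider "v \<in> dom \<phi>" "the (\<phi> v) \<noteq> v" | "v \<in> ran \<phi>" "inv_into (dom \<phi>) (the \<circ> \<phi>) v \<noteq> v"
    unfolding supp_def by blast
  then show ?thesis
  proof cases
    case 1 then show ?thesis using that(1) by auto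
  next
    case 2
    then obtain u where u: "\<phi> u = Some v" by (auto simp: ran_def)
    have inj: "inj_on (the \<circ> \<phi>) (dom \<phi>)" using assms(1) by (auto simp: partial_aut_def graph_iso_def bij_betw_def)
    have "inv_into (dom \<phi>) (the \<circ> \<phi>) v = u" using inv_into_f_f[OF inj, of u] u by auto
    then show ?thesis using that(2)[of u] u 2 by simp
  qed
qed

lemma card_sym_diff:
  assumes "finite A" "finite B"
  shows "card (sym_diff A B) + 2 * card (A \<inter> B) = card A + card B"
proof -
  have "card (sym_diff A B) = card (A - B) + card (B - A)"
    using assms by (intro card_Un_disjoint) auto
  moreover have "card (A - B) + card (A \<inter> B) = card A" "card (B - A) + card (A \<inter> B) = card B"
    using card_Int_Diff[OF assms(1), of B] card_Int_Diff[OF assms(2), of A] by (simp_all add: Int_commute)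
  ultimately show ?thesis by linarith
qed

text \<open>
  Vertices of \<open>A\<close> are added one after the other. Of the at most three edges of a vertex, at most one
  leads to one of the two sides; the vertex joins the other side.
\<close>

lemma balanced_split:
  assumes "finite A" "finite E" "\<And>a. a \<in> A \<Longrightarrow> card {e \<in> E. a \<in> e} \<le> 3" "\<And>e. e \<in> E \<Longrightarrow> card e = 2"
    "A \<inter> (C \<union> R) = {}" "C \<inter> R = {}"
  shows "\<exists>X. C \<subseteq> X \<and> X \<subseteq> C \<union> A \<and>
    card (edges_between E X (C \<union> R \<union> A - X)) \<le> card (edges_between E C R) + card A"
  using assms
proof (induction A)
  case empty
  have "C \<union> R \<union> {} - C = R" using empty by blast
  then show ?case by (intro exI[of _ C]) simp
next
  case (insert a A)
  then obtain X where X: "C \<subseteq> X" "X \<subseteq> C \<union> A"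
    "card (edges_between E X (C \<union> R \<union> A - X)) \<le> card (edges_between E C R) + card A" by auto
  let ?Y = "C \<union> R \<union> A - X"
  have aX: "a \<notin> X" "a \<notin> ?Y" using X insert by auto
  let ?eX = "{e \<in> E. a \<in> e \<and> e \<inter> X \<noteq> {}}" and ?eY = "{e \<in> E. a \<in> e \<and> e \<inter> ?Y \<noteq> {}}"
  have fin: "finite ?eX" "finite ?eY" "finite (edges_between E X ?Y)"
    using insert(4) by (auto simp: edges_between_def)
  have "?eX \<inter> ?eY = {}"
  proof (rule equals0I)
    fix e assume "e \<in> ?eX \<inter> ?eY"
    then obtain x y where xy: "x \<in> e" "x \<in> X" "y \<in> e" "y \<in> ?Y" "a \<in> e" "e \<in> E" by blast
    have "card e = 2" using insert(6) xy by blast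
    then have "finite e" using card.infinite by fastforce
    moreover have "a \<noteq> x" "a \<noteq> y" "x \<noteq> y" using xy aX by blast+
    then have "card {a, x, y} = 3" by simp
    ultimately show False using card_mono[of e "{a, x, y}"] xy \<open>card e = 2\<close> by simp
  qed
  then have "card ?eX + card ?eY = card (?eX \<union> ?eY)" using fin by (simp add: card_Un_disjoint)
  also have "\<dots> \<le> card {e \<in> E. a \<in> e}" using insert(4) by (intro card_mono) auto
  also have "\<dots> \<le> 3" using insert(5) by simp
  finally consider "card ?eY \<le> 1" | "card ?eX \<le> 1" by linarith
  then show ?case
  proof cases
    case 1
    have eq: "C \<union> R \<union> insert a A - insert a X = ?Y" using aX by blast
    have "edges_between E (insert a X) ?Y \<subseteq> edges_between E X ?Y \<union> ?eY"
      by (auto simp: edges_between_def)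
    then have "card (edges_between E (insert a X) ?Y) \<le> card (edges_between E X ?Y \<union> ?eY)"
      using fin by (intro card_mono) auto
    also have "\<dots> \<le> card (edges_between E X ?Y) + card ?eY" by (rule card_Un_le)
    also have "\<dots> \<le> card (edges_between E C R) + card (insert a A)" using 1 X(3) insert(1,2) by simp
    finally show ?thesis using eq X by (intro exI[of _ "insert a X"]) auto
  next
    case 2
    have eq: "C \<union> R \<union> insert a A - X = insert a ?Y" using aX by blast
    have "edges_between E X (insert a ?Y) \<subseteq> edges_between E X ?Y \<union> ?eX"
      by (auto simp: edges_between_def)
    then have "card (edges_between E X (insert a ?Y)) \<le> card (edges_between E X ?Y \<union> ?eX)"
      using fin by (intro card_mono) auto
    also have "\<dots> \<le> card (edges_between E X ?Y) + card ?eX" by (rule card_Un_le)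
    also have "\<dots> \<le> card (edges_between E C R) + card (insert a A)" using 2 X(3) insert(1,2) by simp
    finally show ?thesis using eq X by (intro exI[of _ X]) auto
  qed
qed

context polyhedral_map
begin

lemma nbrs_iff: "w \<in> nbrs E v \<longleftrightarrow> {v, w} \<in> E" by (simp add: nbrs_def)

lemma finite_nbrs: "finite (nbrs E v)"
  using finite_V edge_in_V by (auto simp: nbrs_def intro: finite_subset)

lemma card_nbrs: "v \<in> V \<Longrightarrow> card (nbrs E v) = 3"
  using is_cubic by (simp add: cubic_def)

text \<open>
  Adjacent vertices have no common neighbour and other vertices have at most one. Besides full
  neighbourhoods (\<open>k = 3\<close>), this is used for the neighbourhoods inside a face (\<open>k = 2\<close>).
\<close>

lemma neighbourhoods_differ:
  assumes "u \<noteq> v" and P: "P \<subseteq> nbrs E u" "card P = k" "v \<in> P \<longleftrightarrow> {u, v} \<in> E"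
    and Q: "Q \<subseteq> nbrs E v" "card Q = k" "u \<in> Q \<longleftrightarrow> {u, v} \<in> E"
  shows "2 * k \<le> card (sym_diff (P - {v}) (Q - {u})) + 2"
proof -
  have fin: "finite P" "finite Q" using P Q finite_nbrs finite_subset by blast+
  note sd = card_sym_diff[OF finite_Diff[OF fin(1)] finite_Diff[OF fin(2)], of "{v}" "{u}"]
  show ?thesis
  proof (cases "{u, v} \<in> E")
    case True
    have "(P - {v}) \<inter> (Q - {u}) = {}"
    proof (rule equals0I)
      fix w assume "w \<in> (P - {v}) \<inter> (Q - {u})"
      then have "{u, w} \<in> E" "{v, w} \<in> E" using P Q nbrs_iff by blast+
      then show False using no_triangle[of u v w] True by simp
    qed
    moreover have "card (P - {v}) = k - 1" "card (Q - {u}) = k - 1" using True P Q fin by simp_all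
    ultimately show ?thesis using sd by simp
  next
    case False
    then have eq: "P - {v} = P" "Q - {u} = Q" using P Q by auto
    have "card (P \<inter> Q) \<le> 1"
    proof (rule ccontr)
      assume "\<not> card (P \<inter> Q) \<le> 1"
      then obtain a b where ab: "a \<in> P \<inter> Q" "b \<in> P \<inter> Q" "a \<noteq> b"
        by (metis card_le_Suc0_iff_eq One_nat_def fin(1) finite_Int)
      then have "{u, a} \<in> E" "{v, a} \<in> E" "{u, b} \<in> E" "{v, b} \<in> E" using P Q nbrs_iff by blast+
      then show False using no_4_cycle[of u a v b] assms(1) ab(3) by (simp add: insert_commute)
    qed
    then show ?thesis using sd P Q unfolding eq by linarith
  qed
qed

lemma card_Delta:
  assumes "u \<in> V" "v \<in> V" "u \<noteq> v" shows "4 \<le> card (Delta E u v)"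
proof -
  have "2 * 3 \<le> card (Delta E u v) + 2"
    unfolding Delta_def
    by (rule neighbourhoods_differ) (use assms card_nbrs in \<open>auto simp: nbrs_iff insert_commute\<close>)
  then show ?thesis by simp
qed

text \<open>
  If \<open>x\<close> is moved to \<open>y\<close>, a vertex \<open>z\<close> adjacent to exactly one of them cannot be fixed. If it were
  moved, then \<open>\<phi>\<close> would permute \<open>x\<close>, \<open>y\<close>, \<open>z\<close> cyclically, so these would be pairwise adjacent or
  pairwise not adjacent. So \<open>z\<close> is missing, and there are at least four such \<open>z\<close>.
\<close>

lemma few_moved_vertices:
  assumes \<phi>: "partial_aut V E \<phi>" and miss: "card (V - dom \<phi>) \<le> 3"
    and D: "D \<subseteq> dom \<phi>" "card D \<le> 3" "bij_betw (the \<circ> \<phi>) D D" "\<And>v. v \<in> dom \<phi> - D \<Longrightarrow> \<phi> v = Some v"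
    and x: "x \<in> D" "\<phi> x \<noteq> Some x"
  shows False
proof -
  have domV: "dom \<phi> \<subseteq> V" using \<phi> by (simp add: partial_aut_def)
  have fD: "finite D" by (rule finite_subset[OF subset_trans[OF D(1) domV] finite_V])
  have img: "\<exists>w\<in>D. \<phi> v = Some w" if v: "v \<in> D" for v
  proof -
    obtain w where w: "\<phi> v = Some w" using D(1) v by blast
    moreover have "(the \<circ> \<phi>) v \<in> D" using D(3) v by (auto simp: bij_betw_def)
    ultimately show ?thesis by simp
  qed
  obtain y where y: "y \<in> D" "\<phi> x = Some y" using img x by blast
  have xy: "x \<noteq> y" using x y by auto
  have "Delta E x y \<subseteq> V - dom \<phi>"
  proof
    fix z assume z: "z \<in> Delta E x y"
    then have zV: "z \<in> V" and zxy: "z \<noteq> x" "z \<noteq> y" and one: "({z, x} \<in> E) \<noteq> ({z, y} \<in> E)"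
      using edge_in_V edge_neq by (auto simp: Delta_def nbrs_def insert_commute)
    have "z \<notin> dom \<phi>"
    proof
      assume zd: "z \<in> dom \<phi>"
      show False
      proof (cases "\<phi> z = Some z")
        case True
        then show False using partial_aut_edge[OF \<phi> True y(2)] one by simp
      next
        case False
        then have zD: "z \<in> D" using D(4) zd by blast
        have "card {x, y, z} = 3" using xy zxy by auto
        then have Deq: "D = {x, y, z}"
          using card_seteq[OF fD, of "{x, y, z}"] x(1) y(1) zD D(2) by auto
        obtain y' where y': "y' \<in> D" "\<phi> y = Some y'" using img y(1) by blast
        obtain z' where z': "z' \<in> D" "\<phi> z = Some z'" using img zD by blast
        have "z' \<noteq> z" using z'(2) False by blast
        moreover have "z' \<noteq> y" using partial_aut_inj[OF \<phi> z'(2)] y(2) zxy(1) by blast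
        ultimately have "z' = x" using z'(1) Deq by blast
        then have "y' \<noteq> x" using partial_aut_inj[OF \<phi> y'(2)] z'(2) zxy(2) by blast
        moreover have "y' \<noteq> y" using partial_aut_inj[OF \<phi> y'(2)] y(2) xy by blast
        ultimately have "y' = z" using y'(1) Deq by blast
        then have yz: "\<phi> y = Some z" "\<phi> z = Some x" using y'(2) z'(2) \<open>z' = x\<close> by simp_all
        then have "{z, x} \<in> E \<longleftrightarrow> {x, y} \<in> E" "{y, x} \<in> E \<longleftrightarrow> {z, y} \<in> E"
          using partial_aut_edge[OF \<phi> yz(2) y(2)] partial_aut_edge[OF \<phi> yz(1) y(2)] by simp_all
        then show False using one by (simp add: insert_commute)
      qed
    qed
    then show "z \<in> V - dom \<phi>" using zV by simp
  qed
  then have "card (Delta E x y) \<le> card (V - dom \<phi>)" using finite_V by (intro card_mono) auto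
  moreover have "x \<in> V" "y \<in> V" using x(1) y(1) D(1) domV by blast+
  ultimately show False using card_Delta[of x y] miss xy by linarith
qed

lemma card_face_nbrs:
  assumes f: "f \<in> F" "v \<in> fv f" shows "card (nbrs E v \<inter> fv f) = 2"
proof -
  have "{e \<in> bd f. v \<in> e} = (\<lambda>w. {v, w}) ` (nbrs E v \<inter> fv f)"
  proof
    show "{e \<in> bd f. v \<in> e} \<subseteq> (\<lambda>w. {v, w}) ` (nbrs E v \<inter> fv f)"
    proof
      fix e assume e: "e \<in> {e \<in> bd f. v \<in> e}"
      then have eE: "e \<in> E" "v \<in> e" using bd_E[OF f(1)] by auto
      then obtain w where w: "e = {v, w}" by (rule edge_at)
      then have "w \<in> nbrs E v \<inter> fv f" using e eE bd_fv[of e f] by (auto simp: nbrs_def)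
      then show "e \<in> (\<lambda>w. {v, w}) ` (nbrs E v \<inter> fv f)" using w by blast
    qed
    show "(\<lambda>w. {v, w}) ` (nbrs E v \<inter> fv f) \<subseteq> {e \<in> bd f. v \<in> e}"
      using face_induced[OF f] by (auto simp: nbrs_def)
  qed
  moreover have "inj_on (\<lambda>w. {v, w}) (nbrs E v \<inter> fv f)" by (auto simp: inj_on_def doubleton_eq_iff)
  ultimately show ?thesis using face_degree[OF f] by (simp add: card_image)
qed

end

context ipr_map
begin

text \<open>
  The outer neighbour of a support vertex \<open>v\<close> is not in the support. If it were in the domain, it
  would be fixed and adjacent both to \<open>v\<close> and to the image or preimage of \<open>v\<close> on the face. So the
  outer neighbours of the support are distinct missing vertices, and the support has at most three
  vertices.
\<close>

lemma not_face_localised: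
  assumes \<phi>: "partial_aut V E \<phi>" "nontrivial \<phi>" and miss: "card (V - dom \<phi>) \<le> 3" and f: "f \<in> F"
  shows "\<not> supp \<phi> \<subseteq> fv f"
proof
  assume sub: "supp \<phi> \<subseteq> fv f"
  let ?N = "fv f" and ?S = "supp \<phi>" and ?A = "V - dom \<phi>"
  have fN: "finite ?N" by (rule finite_fv[OF f])
  then have fS: "finite ?S" using sub finite_subset by blast
  have fA: "finite ?A" using finite_V by simp
  have NV: "?N \<subseteq> V" by (rule fv_V[OF f])
  have fixed: "\<phi> z = Some z" if z: "z \<in> V" "z \<notin> ?A" "z \<notin> ?S" for z
  proof (rule ccontr)
    assume "\<phi> z \<noteq> Some z"
    moreover obtain w where "\<phi> z = Some w" using z by blast
    ultimately have "\<phi> z = Some w" "z \<noteq> w" by auto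
    then show False using supp_moved(1)[OF \<phi>(1)] z by blast
  qed
  \<comment> \<open>Exactly one neighbour of a face vertex is off the face.\<close>
  define out where "out v = (SOME w. w \<in> nbrs E v \<and> w \<notin> ?N)" for v
  have out: "{v, out v} \<in> E" "out v \<notin> ?N" if v: "v \<in> ?N" for v
  proof -
    have "\<not> nbrs E v \<subseteq> ?N"
    proof
      assume "nbrs E v \<subseteq> ?N"
      then have "nbrs E v \<inter> ?N = nbrs E v" by (rule Int_absorb2)
      moreover have "v \<in> V" using v NV by (rule subsetD[rotated])
      ultimately show False using card_face_nbrs[OF f v] card_nbrs[of v] by simp
    qed
    then have "\<exists>w. w \<in> nbrs E v \<and> w \<notin> ?N" by blast
    then have "out v \<in> nbrs E v \<and> out v \<notin> ?N" unfolding out_def by (rule someI_ex)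
    then show "{v, out v} \<in> E" "out v \<notin> ?N" by (auto simp: nbrs_def)
  qed
  have out_inj: "inj_on out ?N"
  proof (rule inj_onI, rule ccontr)
    fix v w assume vw: "v \<in> ?N" "w \<in> ?N" "out v = out w" "v \<noteq> w"
    show False
      using no_outer_common_neighbour[OF f vw(1,2,4) out(2)[OF vw(1)]] out(1)[OF vw(1)] out(1)[OF vw(2)] vw(3)
      by (simp add: insert_commute)
  qed
  have out_missing: "out v \<in> ?A" if v: "v \<in> ?S" for v
  proof (rule ccontr)
    assume no: "out v \<notin> ?A"
    have vN: "v \<in> ?N" using v sub by blast
    have oV: "out v \<in> V" using out(1)[OF vN] edge_in_V by blast
    have fo: "\<phi> (out v) = Some (out v)" using fixed[OF oV no] out(2)[OF vN] sub by blast
    obtain w where w: "w \<in> ?S" "w \<noteq> v" "{out v, w} \<in> E"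
      using \<phi>(1) v
    proof (cases rule: supp_cases)
      case (1 w)
      then have "{out v, w} \<in> E" using partial_aut_edge[OF \<phi>(1) fo 1(1)] out(1)[OF vN] by (simp add: insert_commute)
      then show ?thesis using that[of w] supp_moved(2)[OF \<phi>(1) 1(1)] 1(2) by blast
    next
      case (2 u)
      then have "{out v, u} \<in> E" using partial_aut_edge[OF \<phi>(1) fo 2(1)] out(1)[OF vN] by (simp add: insert_commute)
      then show ?thesis using that[of u] supp_moved(1)[OF \<phi>(1) 2(1)] 2(2) by blast
    qed
    then show False
      using no_outer_common_neighbour[OF f vN _ _ out(2)[OF vN], of w] sub out(1)[OF vN]
      by (auto simp: insert_commute)
  qed
  have "out ` ?S \<subseteq> ?A - ?N" using out_missing out(2) sub by blast
  then have "card (out ` ?S) \<le> card (?A - ?N)" using fA by (intro card_mono) auto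
  moreover have "card (out ` ?S) = card ?S" using out_inj sub by (meson card_image inj_on_subset)
  moreover have "card ?A = card (?A \<inter> ?N) + card (?A - ?N)" using card_Int_Diff[OF fA] by blast
  ultimately have bound: "card ?S + card (?A \<inter> ?N) \<le> 3" using miss by linarith
  obtain x y where xy: "\<phi> x = Some y" "x \<noteq> y" using \<phi>(2) by (auto simp: nontrivial_def)
  have S2: "x \<in> ?S" "y \<in> ?S" using supp_moved[OF \<phi>(1) xy] by auto
  then have N2: "x \<in> ?N" "y \<in> ?N" using sub by auto
  have "card {x, y} \<le> card ?S" using S2 by (intro card_mono[OF fS]) auto
  then consider "card ?S = 2" | "card ?S = 3" using bound xy(2) by fastforce
  then show False
  proof cases
    case 1
    then have Seq: "?S = {x, y}" using card_seteq[OF fS, of "{x, y}"] S2 xy(2) by auto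
    \<comment> \<open>With two support vertices, one vertex of the face at most is missing, too few to make up for the difference of the two neighbourhoods in the face.\<close>
    let ?P = "nbrs E x \<inter> ?N" and ?Q = "nbrs E y \<inter> ?N"
    have "2 * 2 \<le> card (sym_diff (?P - {y}) (?Q - {x})) + 2"
        by (rule neighbourhoods_differ) (use xy(2) N2 card_face_nbrs[OF f] in \<open>auto simp: nbrs_iff insert_commute\<close>)
    moreover have "sym_diff (?P - {y}) (?Q - {x}) \<subseteq> ?A \<inter> ?N"
    proof
      fix z assume z: "z \<in> sym_diff (?P - {y}) (?Q - {x})"
      then have "z \<noteq> x" "z \<noteq> y" "z \<in> ?N" and one: "({z, x} \<in> E) \<noteq> ({z, y} \<in> E)"
        using edge_neq by (auto simp: nbrs_def insert_commute)
      moreover have "z \<in> ?A"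
      proof (rule ccontr)
        assume "z \<notin> ?A"
        then have "\<phi> z = Some z" using fixed[of z] NV \<open>z \<in> ?N\<close> Seq \<open>z \<noteq> x\<close> \<open>z \<noteq> y\<close> by blast
        then show False using partial_aut_edge[OF \<phi>(1) _ xy(1), of z z] one by simp
      qed
      ultimately show "z \<in> ?A \<inter> ?N" by blast
    qed
    then have "card (sym_diff (?P - {y}) (?Q - {x})) \<le> card (?A \<inter> ?N)" using fA by (intro card_mono) auto
    ultimately show False using bound 1 by linarith
  next
    case 2
    \<comment> \<open>With three support vertices, no vertex of the face is missing, so the support is permuted cyclically; a fixed face vertex next to it would have three neighbours on the face.\<close>
    then have "card (?A \<inter> ?N) = 0" using bound by linarith
    then have AN: "?A \<inter> ?N = {}" using fA by simp
    have moved: "\<exists>w. \<phi> v = Some w \<and> w \<noteq> v \<and> w \<in> ?S" if v: "v \<in> ?S" for v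
    proof -
      have "v \<in> dom \<phi>" using v sub NV AN by blast
      then obtain w where w: "\<phi> v = Some w" by blast
      have "w \<noteq> v"
        using \<phi>(1) v
      proof (cases rule: supp_cases)
        case (2 u) then show ?thesis using partial_aut_inj[OF \<phi>(1) w] by blast
      qed (use w in auto)
      then show ?thesis using w supp_moved(2)[OF \<phi>(1) w] by blast
    qed
    obtain z where z: "z \<in> ?S" "z \<noteq> x" "z \<noteq> y"
    proof -
      have "\<not> ?S \<subseteq> {x, y}" using card_mono[of "{x, y}" ?S] 2 xy(2) by auto
      then show ?thesis using that by blast
    qed
    have "card {x, y, z} = 3" using z xy(2) by auto
    then have Seq: "?S = {x, y, z}" using card_seteq[OF fS, of "{x, y, z}"] S2 z(1) 2 by auto
    obtain y' where y': "\<phi> y = Some y'" "y' \<noteq> y" "y' \<in> ?S" using moved S2 by blast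
    obtain z' where z': "\<phi> z = Some z'" "z' \<noteq> z" "z' \<in> ?S" using moved z by blast
    have "z' \<noteq> y" using partial_aut_inj[OF \<phi>(1) z'(1)] xy(1) z(2) by blast
    then have "z' = x" using z'(2,3) Seq by blast
    then have zx: "\<phi> z = Some x" using z'(1) by simp
    then have "y' \<noteq> x" using partial_aut_inj[OF \<phi>(1) y'(1)] z(3) by blast
    then have "y' = z" using y'(2,3) Seq by blast
    then have yz: "\<phi> y = Some z" using y'(1) by simp
    have "nbrs E x \<inter> ?N \<subseteq> {y, z}"
    proof (rule ccontr)
      assume "\<not> ?thesis"
      then obtain p where p: "p \<in> ?N" "{p, x} \<in> E" "p \<noteq> y" "p \<noteq> z" by (auto simp: nbrs_def insert_commute)
      have "p \<noteq> x" using p(2) edge_neq by blast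
      then have fp: "\<phi> p = Some p" using fixed[of p] p AN NV Seq by blast
      then have py: "{p, y} \<in> E" using partial_aut_edge[OF \<phi>(1) fp xy(1)] p by simp
      then have "{p, z} \<in> E" using partial_aut_edge[OF \<phi>(1) fp yz] by simp
      then have "{x, y, z} \<subseteq> nbrs E p \<inter> ?N" using p py Seq sub by (auto simp: nbrs_def)
      then have "card {x, y, z} \<le> card (nbrs E p \<inter> ?N)" using fN by (intro card_mono) auto
      then show False using card_face_nbrs[OF f p(1)] \<open>card {x, y, z} = 3\<close> by simp
    qed
    moreover have "card (nbrs E x \<inter> ?N) = card {y, z}" using card_face_nbrs[OF f N2(1)] z by simp
    ultimately have "nbrs E x \<inter> ?N = {y, z}" by (intro card_subset_eq) auto
    then have "{x, y} \<in> E" "{x, z} \<in> E" using nbrs_iff by blast+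
    moreover then have "{y, z} \<in> E" using partial_aut_edge[OF \<phi>(1) xy(1) yz] by simp
    ultimately show False using no_triangle[of x y z] by blast
  qed
qed

lemma not_local_transposition:
  assumes "card (V - dom \<phi>) \<le> 3" "u \<in> V" "v \<in> V" "u \<noteq> v"
  shows "\<phi> \<noteq> local_transposition V E u v"
proof
  assume eq: "\<phi> = local_transposition V E u v"
  have DV: "Delta E u v \<subseteq> V" using edge_in_V by (auto simp: Delta_def nbrs_def)
  have "dom \<phi> = V - Delta E u v" by (auto simp: eq local_transposition_def dom_def split: if_splits)
  then have "V - dom \<phi> = Delta E u v" using DV by blast
  then show False using card_Delta[OF assms(2-4)] assms(1) by simp
qed

text \<open>
  Sharing out the missing vertices turns the few edges between \<open>C\<close> and the rest into an edge cut of the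
  whole graph with at most five edges, whose side around \<open>C\<close> must be the small one.
\<close>

lemma not_weakly_attached:
  assumes \<phi>: "partial_aut V E \<phi>" "nontrivial \<phi>" and d: "card (V - dom \<phi>) \<le> d" "d \<le> 3"
    and C: "C \<subseteq> dom \<phi>" "nontrivial_graph_aut C (induced_edges E C) \<alpha>" "\<And>x. x \<in> C \<Longrightarrow> \<phi> x = Some (\<alpha> x)"
    and R: "\<And>x. x \<in> dom \<phi> - C \<Longrightarrow> \<phi> x = Some x" "6 \<le> card (dom \<phi> - C)"
    and few: "card (edges_between E C (dom \<phi> - C)) \<le> 5 - d"
  shows False
proof -
  let ?R = "dom \<phi> - C" and ?A = "V - dom \<phi>"
  have miss: "card ?A \<le> 3" using d by linarith
  have domV: "dom \<phi> \<subseteq> V" using \<phi> by (simp add: partial_aut_def)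
  have bij: "bij_betw \<alpha> C C" using C(2) by (auto simp: nontrivial_graph_aut_def graph_aut_def graph_iso_def)
  obtain x where x: "x \<in> C" "\<alpha> x \<noteq> x" using C(2) by (auto simp: nontrivial_graph_aut_def)
  have VV: "C \<union> ?R \<union> ?A = V" using C(1) domV by blast
  have "\<exists>X. C \<subseteq> X \<and> X \<subseteq> C \<union> ?A \<and> card (edges_between E X (C \<union> ?R \<union> ?A - X)) \<le> card (edges_between E C ?R) + card ?A"
    by (rule balanced_split) (use finite_V finite_E card_incident edge_card C(1) in auto)
  then obtain X where X: "C \<subseteq> X" "X \<subseteq> C \<union> ?A"
    "card (edges_between E X (V - X)) \<le> card (edges_between E C ?R) + card ?A"
    unfolding VV by blast
  have XV: "X \<subseteq> V" using X VV by blast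
  have "cut X \<subseteq> edges_between E X (V - X)" using edge_V unfolding cut_def edges_between_def by blast
  then have "card (cut X) \<le> card (edges_between E X (V - X))"
    using finite_E by (intro card_mono) (auto simp: edges_between_def)
  then have cX: "card (cut X) \<le> 5" using X(3) few d by linarith
  have "?R \<subseteq> V - X" using X domV by blast
  then have "card ?R \<le> card (V - X)" using finite_V by (intro card_mono) auto
  then have X5: "card X \<le> 5" using small_cut_small_side[OF XV cX] R(2) by linarith
  have fX: "finite X" using XV finite_V finite_subset by blast
  have "X \<noteq> {}" using X x by blast
  from small_side[OF XV this X5] show False
  proof
    assume "card X + 2 \<le> card (cut X)"
    then have C3: "card C \<le> 3" using cX card_mono[OF fX X(1)] by linarith
    have "bij_betw (the \<circ> \<phi>) C C" using bij C(3) by (simp cong: bij_betw_cong)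
    then show False using few_moved_vertices[OF \<phi>(1) miss C(1) C3 _ R(1) x(1)] C(3) x by auto
  next
    assume "\<exists>f\<in>F. fv f = X \<and> card X = 5 \<and> card (cut X) = 5"
    then obtain f where f: "f \<in> F" "fv f = X" by blast
    have "supp \<phi> \<subseteq> C"
    proof
      fix v assume v: "v \<in> supp \<phi>"
      show "v \<in> C"
        using \<phi>(1) v
      proof (cases rule: supp_cases)
        case (1 w) then show ?thesis using R(1)[of v] by auto
      next
        case (2 u)
        then have "u \<in> C" using R(1)[of u] by auto
        then show ?thesis using C(3)[of u] 2 bij by (auto simp: bij_betw_def)
      qed
    qed
    then show False using not_face_localised[OF \<phi> miss f(1)] f X by blast
  qed
qed

end

section \<open>Fullerenes\<close>

lemma (in plane_graph) face_verts_Union: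
  assumes "cycle_in E vs" "frontier f = cyc_im vs"
  shows "face_verts V pos f = \<Union>(cycle_edges vs)"
proof
  have c: "cycle_edges vs \<subseteq> E" using assms by (simp add: cycle_in_def)
  show "face_verts V pos f \<subseteq> \<Union>(cycle_edges vs)"
  proof
    fix v assume "v \<in> face_verts V pos f"
    then obtain e where e: "v \<in> V" "e \<in> cycle_edges vs" "pos v \<in> im e"
      using assms(2) by (auto simp: face_verts_def)
    then show "v \<in> \<Union>(cycle_edges vs)" using im_vertex[of e v] c by blast
  qed
  show "\<Union>(cycle_edges vs) \<subseteq> face_verts V pos f"
  proof
    fix v assume "v \<in> \<Union>(cycle_edges vs)"
    then obtain e where e: "e \<in> cycle_edges vs" "v \<in> e" by blast
    then have eE: "e \<in> E" using c by blast
    then have "v \<in> V" "pos v \<in> im e" using edge_V[OF eE] curve_vertices[OF eE] e(2) by blast+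
    then show "v \<in> face_verts V pos f" using e(1) assms(2) by (auto simp: face_verts_def)
  qed
qed

text \<open>
  The plane drawing enters the combinatorial part only through this lemma.
\<close>

lemma IPR_fullerene_map:
  assumes full: "fullerene V E pos curve" and ipr: "IPR V E pos curve"
  shows "ipr_map V E (faces V E pos curve) (face_edges E curve)"
    and "f \<in> faces V E pos curve \<Longrightarrow> face_verts V pos f = \<Union>(face_edges E curve f)"
proof -
  have poly: "k_gonal E curve 5 f \<or> k_gonal E curve 6 f" if "f \<in> faces V E pos curve" for f
    using full that by (simp add: fullerene_def)
  interpret G: polygonal_plane_graph V E pos curve
  proof
    show "simple_graph V E" "plane_embedding V E pos curve" using full by (simp_all add: fullerene_def)
    show "\<exists>k. k_gonal E curve k f" if "f \<in> faces V E pos curve" for f using poly[OF that] by blast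
  qed
  have cyc: "\<exists>vs. cycle_in E vs \<and> length vs = k \<and> face_edges E curve f = cycle_edges vs \<and>
      face_verts V pos f = \<Union>(cycle_edges vs)" if k: "k_gonal E curve k f" for f k
  proof -
    obtain vs where vs: "cycle_in E vs" "length vs = k" "frontier f = (\<Union>e\<in>cycle_edges vs. path_image (curve e))"
      using k unfolding k_gonal_def by blast
    then show ?thesis using G.face_edges_cycle[OF vs(1,3)] G.face_verts_Union[OF vs(1,3)] by blast
  qed
  interpret M: polyhedral_map V E "faces V E pos curve" "face_edges E curve"
  proof
    show "simple_graph V E" "cubic V E" "three_connected V E" using full by (simp_all add: fullerene_def)
    show "finite (faces V E pos curve)" by (rule G.finite_faces)
    show "\<exists>vs. cycle_in E vs \<and> (length vs = 5 \<or> length vs = 6) \<and> face_edges E curve f = cycle_edges vs"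
      if "f \<in> faces V E pos curve" for f
      using poly[OF that] cyc[of 5 f] cyc[of 6 f] by metis
    show "card {f \<in> faces V E pos curve. e \<in> face_edges E curve f} = 2" if "e \<in> E" for e
      using that by (rule G.edge_in_two_faces)
    show "\<exists>S\<subseteq>faces V E pos curve. \<forall>e\<in>E. e \<in> cycle_edges vs \<longleftrightarrow>
        (\<exists>f\<in>S. \<exists>g\<in>faces V E pos curve - S. e \<in> face_edges E curve f \<and> e \<in> face_edges E curve g)"
      if "cycle_in E vs" for vs
      using that by (rule G.cycle_separates_faces)
  qed
  have pent: "k_gonal E curve 5 f" if f: "f \<in> faces V E pos curve" "card (face_edges E curve f) = 5" for f
  proof (rule ccontr)
    assume "\<not> k_gonal E curve 5 f"
    then have hex: "k_gonal E curve 6 f" using poly[OF f(1)] by blast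
    obtain vs where vs: "cycle_in E vs" "length vs = 6" "face_edges E curve f = cycle_edges vs"
      using cyc[OF hex] by auto
    have "vs \<noteq> []" using vs(2) by auto
    then have "M.fv f = set vs" using vs(3) Union_cycle_edges unfolding M.fv_def by simp
    then have "card (M.fv f) = 6" using vs by (simp add: cycle_in_def distinct_card)
    then show False using M.card_bd[OF f(1)] f(2) by simp
  qed
  show "ipr_map V E (faces V E pos curve) (face_edges E curve)"
  proof (unfold_locales, rule ccontr)
    fix f g
    assume fg: "f \<in> faces V E pos curve" "g \<in> faces V E pos curve" "f \<noteq> g"
      "card (face_edges E curve f) = 5" "card (face_edges E curve g) = 5"
      "face_edges E curve f \<inter> face_edges E curve g \<noteq> {}"
    then show False using pent[OF fg(1,4)] pent[OF fg(2,5)] ipr unfolding IPR_def by blast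
  qed
  show "face_verts V pos f = \<Union>(face_edges E curve f)" if "f \<in> faces V E pos curve"
    using poly[OF that] cyc[of 5 f] cyc[of 6 f] by metis
qed

theorem corollary4:
  fixes V :: "'a set" and E :: "'a set set"
    and pos :: "'a \<Rightarrow> complex" and curve :: "'a set \<Rightarrow> real \<Rightarrow> complex"
    and \<phi> :: "'a \<rightharpoonup> 'a" and n :: nat
  assumes "fullerene V E pos curve"
    and "IPR V E pos curve"
    and "asymmetric V E"
    and "card V = n"
    and "asym_depth V E \<in> {2, 3}"
    and "partial_aut V E \<phi>"
    and "nontrivial \<phi>"
    and "pa_rank \<phi> = n - asym_depth V E"
  shows "(\<forall>u\<in>V. \<forall>v\<in>V. u \<noteq> v \<longrightarrow> \<phi> \<noteq> local_transposition V E u v)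
    \<and> \<not> (\<exists>D'. D' \<subseteq> dom \<phi> \<and> card D' \<le> 3
            \<and> nontrivial_graph_aut D' (induced_edges E D') (the \<circ> \<phi>)
            \<and> (\<forall>v\<in>dom \<phi> - D'. \<phi> v = Some v))
    \<and> (\<forall>f\<in>faces V E pos curve. \<not> supp \<phi> \<subseteq> face_verts V pos f)
    \<and> \<not> (\<exists>C \<alpha>. C \<subseteq> dom \<phi>
            \<and> nontrivial_graph_aut C (induced_edges E C) \<alpha>
            \<and> (\<forall>x\<in>C. \<phi> x = Some (\<alpha> x))
            \<and> (\<forall>x\<in>dom \<phi> - C. \<phi> x = Some x)
            \<and> card (dom \<phi> - C) \<ge> 6
            \<and> card (edges_between E C (dom \<phi> - C)) \<le> 5 - asym_depth V E)"
proof -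
  interpret M: ipr_map V E "faces V E pos curve" "face_edges E curve"
    by (rule IPR_fullerene_map[OF assms(1,2)])
  let ?d = "asym_depth V E"
  have d3: "?d \<le> 3" using assms(5) by auto
  have domV: "dom \<phi> \<subseteq> V" using assms(6) by (simp add: partial_aut_def)
  then have "card (V - dom \<phi>) = card V - card (dom \<phi>)"
    using M.finite_V finite_subset by (intro card_Diff_subset) auto
  then have miss: "card (V - dom \<phi>) \<le> ?d" using assms(4,8) by (simp add: pa_rank_def)
  then have miss3: "card (V - dom \<phi>) \<le> 3" using d3 by linarith
  show ?thesis
  proof (intro conjI)
    show "\<forall>u\<in>V. \<forall>v\<in>V. u \<noteq> v \<longrightarrow> \<phi> \<noteq> local_transposition V E u v"
      using M.not_local_transposition[OF miss3] by blast
    show "\<not> (\<exists>D'. D' \<subseteq> dom \<phi> \<and> card D' \<le> 3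
            \<and> nontrivial_graph_aut D' (induced_edges E D') (the \<circ> \<phi>)
            \<and> (\<forall>v\<in>dom \<phi> - D'. \<phi> v = Some v))"
    proof
      assume "\<exists>D'. D' \<subseteq> dom \<phi> \<and> card D' \<le> 3
            \<and> nontrivial_graph_aut D' (induced_edges E D') (the \<circ> \<phi>)
            \<and> (\<forall>v\<in>dom \<phi> - D'. \<phi> v = Some v)"
      then obtain D' where D: "D' \<subseteq> dom \<phi>" "card D' \<le> 3" "\<forall>v\<in>dom \<phi> - D'. \<phi> v = Some v"
        and aut: "nontrivial_graph_aut D' (induced_edges E D') (the \<circ> \<phi>)" by blast
      have bij: "bij_betw (the \<circ> \<phi>) D' D'"
        using aut by (simp add: nontrivial_graph_aut_def graph_aut_def graph_iso_def)
      obtain x where x: "x \<in> D'" "(the \<circ> \<phi>) x \<noteq> x" using aut by (auto simp: nontrivial_graph_aut_def)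
      then have "\<phi> x \<noteq> Some x" by auto
      with M.few_moved_vertices[OF assms(6) miss3 D(1,2) bij _ x(1)] D(3) show False by blast
    qed
    show "\<forall>f\<in>faces V E pos curve. \<not> supp \<phi> \<subseteq> face_verts V pos f"
      using M.not_face_localised[OF assms(6,7) miss3] IPR_fullerene_map(2)[OF assms(1,2)]
      unfolding M.fv_def by metis
    show "\<not> (\<exists>C \<alpha>. C \<subseteq> dom \<phi>
            \<and> nontrivial_graph_aut C (induced_edges E C) \<alpha>
            \<and> (\<forall>x\<in>C. \<phi> x = Some (\<alpha> x))
            \<and> (\<forall>x\<in>dom \<phi> - C. \<phi> x = Some x)
            \<and> card (dom \<phi> - C) \<ge> 6
            \<and> card (edges_between E C (dom \<phi> - C)) \<le> 5 - asym_depth V E)"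
      using M.not_weakly_attached[OF assms(6,7) miss d3] by blast
  qed
qed

end
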